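(* Let $n\geq 3$ and let $\mathcal{C}_n$ be the $n$-qubit Clifford group (modulo global phase). Then the trivial character is the only linear character of $\mathcal{C}_n$ (i.e. the only group homomorphism $\mathcal{C}_n\to\mathbb{C}^\times$ is the trivial one), and hence $\mathcal{C}_n=[\mathcal{C}_n,\mathcal{C}_n]$, where $[\mathcal{C}_n,\mathcal{C}_n]$ denotes the commutator subgroup.
   Context: Let $I_2$ be the $2\times 2$ identity matrix, $X=\begin{pmatrix}0&1\\1&0\end{pmatrix}$, $Y=\begin{pmatrix}0&-i\\ i&0\end{pmatrix}$, $Z=\begin{pmatrix}1&0\\0&-1\end{pmatrix}$. Let $\hat{\mathcal{P}}_n=\{\sigma_1\otimes\cdots\otimes\sigma_n : \sigma_k\in\{I_2,X,Y,Z\}\}$, a set of unitary $2^n\times 2^n$ complex matrices, and let $\langle\hat{\mathcal{P}}_n\rangle$ be the subgroup of the unitary group $U(2^n)$ that it generates. The $n$-qubit Clifford group $\mathcal{C}_n$ is the group of all $A\in U(2^n)$ such that $A\sigma A^{-1}\in\langle\hat{\mathcal{P}}_n\rangle$ for all $\sigma\in\langle\hat{\mathcal{P}}_n\rangle$, modulo the subgroup of scalar unitary matrices (the global phase). It is a finite group of order $2^{n^2+2n}\prod_{j=1}^n(2^{2j}-1)$. A linear character is the character of a one-dimensional complex representation. *)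

theory Defs
  imports
    "HOL-Algebra.Generated_Groups"
    "Jordan_Normal_Form.Schur_Decomposition"
begin

definition unitary_group :: "nat \<Rightarrow> complex mat monoid" where
  "unitary_group N =
     \<lparr>carrier = {A \<in> carrier_mat N N. mat_adjoint A * A = 1\<^sub>m N}, monoid.mult = (*), one = 1\<^sub>m N\<rparr>"

definition kronecker_mat :: "complex mat \<Rightarrow> complex mat \<Rightarrow> complex mat" where
  "kronecker_mat A B =
     mat (dim_row A * dim_row B) (dim_col A * dim_col B)
       (\<lambda>(i, j). A $$ (i div dim_row B, j div dim_col B) * B $$ (i mod dim_row B, j mod dim_col B))"

definition pauli_X :: "complex mat" where
  "pauli_X = mat_of_rows_list 2 [[0, 1], [1, 0]]"

definition pauli_Y :: "complex mat" where
  "pauli_Y = mat_of_rows_list 2 [[0, - \<i>], [\<i>, 0]]"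

definition pauli_Z :: "complex mat" where
  "pauli_Z = mat_of_rows_list 2 [[1, 0], [0, - 1]]"

definition pauli_matrices :: "complex mat set" where
  "pauli_matrices = {1\<^sub>m 2, pauli_X, pauli_Y, pauli_Z}"

text \<open>The \<open>n\<close>-fold tensor product \<open>\<sigma>\<^sub>1 \<otimes> (\<sigma>\<^sub>2 \<otimes> (\<dots> \<otimes> \<sigma>\<^sub>n))\<close>;
  the \<open>1 \<times> 1\<close> identity matrix at the end of the fold is neutral for the Kronecker product.\<close>

definition pauli_strings :: "nat \<Rightarrow> complex mat set" where
  "pauli_strings n =
     {foldr kronecker_mat \<sigma>s (1\<^sub>m 1) | \<sigma>s. length \<sigma>s = n \<and> set \<sigma>s \<subseteq> pauli_matrices}"

definition pauli_group :: "nat \<Rightarrow> complex mat set" where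
  "pauli_group n = generate (unitary_group (2 ^ n)) (pauli_strings n)"

definition clifford_unitaries :: "nat \<Rightarrow> complex mat set" where
  "clifford_unitaries n =
     {A \<in> carrier (unitary_group (2 ^ n)).
        \<forall>\<sigma> \<in> pauli_group n.
          A \<otimes>\<^bsub>unitary_group (2 ^ n)\<^esub> \<sigma> \<otimes>\<^bsub>unitary_group (2 ^ n)\<^esub> inv\<^bsub>unitary_group (2 ^ n)\<^esub> A
            \<in> pauli_group n}"

definition global_phases :: "nat \<Rightarrow> complex mat set" where
  "global_phases N = {A \<in> carrier (unitary_group N). \<exists>c. A = c \<cdot>\<^sub>m 1\<^sub>m N}"

definition clifford_group :: "nat \<Rightarrow> complex mat set monoid" where
  "clifford_group n =
     (unitary_group (2 ^ n))\<lparr>carrier := clifford_unitaries n\<rparr> Mod global_phases (2 ^ n)"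

abbreviation GL :: "nat \<Rightarrow> complex mat monoid" where
  "GL d \<equiv> units_of (ring_mat TYPE(complex) d ())"

abbreviation complex_units :: "complex monoid" where
  "complex_units \<equiv> \<lparr>carrier = UNIV - {0}, monoid.mult = (*), one = 1\<rparr>"

text \<open>As elements outside of the carrier are irrelevant, a character is determined only on the
  carrier of the group.\<close>

definition is_character_of_degree :: "('a, 'b) monoid_scheme \<Rightarrow> nat \<Rightarrow> ('a \<Rightarrow> complex) \<Rightarrow> bool" where
  "is_character_of_degree G d \<chi> \<longleftrightarrow>
     (\<exists>\<rho> \<in> hom G (GL d). \<forall>g \<in> carrier G. \<chi> g = (\<Sum>i<d. \<rho> g $$ (i, i)))"

abbreviation linear_character :: "('a, 'b) monoid_scheme \<Rightarrow> ('a \<Rightarrow> complex) \<Rightarrow> bool" where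
  "linear_character G \<equiv> is_character_of_degree G 1"

end

theory Submission
  imports Defs
begin

text \<open>
  The third claim, perfection, is equivalent to saying that every homomorphism from the Clifford group to a
  commutative group is trivial (apply this to the abelianization), and the two claims about
  characters are the cases of \<open>GL 1\<close> and of the units of \<open>\<complex>\<close>. So let \<open>\<phi>\<close> be a homomorphism from the
  Clifford unitaries to a commutative group that sends all phases to the identity; the
  locale \<open>phase_killing_hom\<close> shows that \<open>\<phi>\<close> is trivial.

  For a Pauli involution \<open>P\<close> let \<open>T P = (1 + \<i>P) / \<surd>2\<close>, the quarter turn about \<open>P\<close>. It is a Clifford unitary
  (modulo Pauli operators and phases it is a symplectic transvection over the field with two elements),
  and a Clifford unitary that conjugates \<open>P\<close> to \<open>Q\<close> conjugates \<open>T P\<close> to \<open>T Q\<close>.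

  First, \<open>\<phi>\<close> is trivial on quarter turns. If \<open>P\<close> and \<open>Q\<close> anticommute, the quarter turn
  about \<open>- \<i>QP\<close> conjugates \<open>P\<close> to \<open>Q\<close> (\<open>quarter_turn_swap\<close>), and any two noncentral Pauli involutions have a
  common anticommuting one (\<open>common_anticommuter\<close>). Hence \<open>\<phi> (T P)\<close> has the same value \<open>t\<close> for all
  noncentral \<open>P\<close>. Since \<open>T (- P) T P = 1\<close>, we get \<open>t\<^sup>2 = 1\<close>. An odd relation needs three qubits: for
  commuting involutions \<open>A\<close>, \<open>B\<close> the product \<open>T (- A) T (- B) T (AB)\<close> is, up to a phase, the operator
  \<open>CZ(A, B)\<close> that acts as \<open>1\<close> on the \<open>1\<close>-eigenspace of \<open>A\<close> and as \<open>B\<close> on its \<open>(- 1)\<close>-eigenspace.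
  Clearly \<open>CZ(A, B) CZ(A, C) = CZ(A, BC)\<close>; with \<open>A\<close>, \<open>B\<close>, \<open>C\<close> the operator \<open>Z\<close> on three different qubits,
  all products involved are noncentral, and applying \<open>\<phi>\<close> gives \<open>t\<^sup>6 = t\<^sup>3\<close>. So \<open>t = 1\<close>.

  Second, quarter turns and phases generate. Given a Clifford unitary \<open>A\<close>, multiply it from the left
  by quarter turns that move \<open>A X\<^sub>k A\<^sup>-\<^sup>1\<close> back to \<open>X\<^sub>k\<close> and then \<open>A Z\<^sub>k A\<^sup>-\<^sup>1\<close> back to \<open>Z\<^sub>k\<close>, for one qubit \<open>k\<close> after
  another, without disturbing what is already fixed (\<open>reduce_X\<close>, \<open>reduce_Z\<close>). In the end \<open>A\<close> commutes with all
  \<open>X\<^sub>k\<close> and \<open>Z\<^sub>k\<close>, so it is a scalar (\<open>commutant_of_sites\<close>), on which \<open>\<phi>\<close> is trivial by assumption.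
\<close>

section \<open>Kronecker products with a two-by-two left factor\<close>

lemma kronecker_mat_carrier [simp]:
  "A \<in> carrier_mat a b \<Longrightarrow> B \<in> carrier_mat c d \<Longrightarrow> kronecker_mat A B \<in> carrier_mat (a * c) (b * d)"
  by (auto simp: kronecker_mat_def)

text \<open>Only left factors of size two occur below, so Kronecker products can be computed with
  the block matrices of the library.\<close>

lemma kronecker_mat_four_block:
  assumes "A \<in> carrier_mat 2 2" "B \<in> carrier_mat M M"
  shows "kronecker_mat A B = four_block_mat (A $$ (0, 0) \<cdot>\<^sub>m B) (A $$ (0, 1) \<cdot>\<^sub>m B)
                                            (A $$ (1, 0) \<cdot>\<^sub>m B) (A $$ (1, 1) \<cdot>\<^sub>m B)"
proof -
  have div_mod: "i div M = (if i < M then 0 else 1) \<and> i mod M = (if i < M then i else i - M)"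
    if "i < 2 * M" for i
    using that by (auto simp: div_nat_eqI mod_if)
  show ?thesis
    using assms by (intro eq_matI) (auto simp: kronecker_mat_def div_mod)
qed

lemma smult_smult_mat: "a \<cdot>\<^sub>m (b \<cdot>\<^sub>m A) = (a * b) \<cdot>\<^sub>m (A :: 'a :: semigroup_mult mat)"
  by (intro eq_matI) (auto simp: mult.assoc)

lemma one_smult_mat: "1 \<cdot>\<^sub>m A = (A :: 'a :: monoid_mult mat)"
  by (intro eq_matI) auto

lemma zero_smult_mat: "0 \<cdot>\<^sub>m A = 0\<^sub>m (dim_row A) (dim_col (A :: 'a :: mult_zero mat))"
  by (intro eq_matI) auto

lemma kronecker_mat_mult:
  assumes A: "A \<in> carrier_mat 2 2" and C: "C \<in> carrier_mat 2 2"
    and B: "B \<in> carrier_mat M M" and D: "D \<in> carrier_mat M M"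
  shows "kronecker_mat A B * kronecker_mat C D = kronecker_mat (A * C) (B * D)"
proof -
  have AC: "A * C \<in> carrier_mat 2 2" and BD: "B * D \<in> carrier_mat M M"
    using assms by auto
  have entry: "(A * C) $$ (i, j) = A $$ (i, 0) * C $$ (0, j) + A $$ (i, 1) * C $$ (1, j)"
    if "i < 2" "j < 2" for i j
    using that A C by (auto simp: scalar_prod_def numeral_2_eq_2)
  have block: "(a \<cdot>\<^sub>m B) * (c \<cdot>\<^sub>m D) + (b \<cdot>\<^sub>m B) * (d \<cdot>\<^sub>m D) = (a * c + b * d) \<cdot>\<^sub>m (B * D)" for a b c d
  proof -
    have "(x \<cdot>\<^sub>m B) * (y \<cdot>\<^sub>m D) = (x * y) \<cdot>\<^sub>m (B * D)" for x y
      using B D by (simp add: mult_smult_assoc_mat[of _ M M _ M] mult_smult_distrib[of _ M M _ M]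
          smult_smult_mat mult.commute)
    then show ?thesis
      using B D by (simp add: add_smult_distrib_right_mat[of _ M M])
  qed
  show ?thesis
    unfolding kronecker_mat_four_block[OF A B] kronecker_mat_four_block[OF C D]
      kronecker_mat_four_block[OF AC BD]
    by (subst mult_four_block_mat[where ?nr1.0 = M and ?n1.0 = M and ?n2.0 = M and ?nr2.0 = M
          and ?nc1.0 = M and ?nc2.0 = M])
      (use B D in \<open>auto simp: block entry\<close>)
qed

lemma kronecker_mat_one: "0 < M \<Longrightarrow> kronecker_mat (1\<^sub>m 2) (1\<^sub>m M) = 1\<^sub>m (2 * M)"
  using four_block_one_mat[of M M, where ?'a = complex]
  by (subst kronecker_mat_four_block[where M = M]) (auto simp: mult_2 one_smult_mat zero_smult_mat)

lemma kronecker_mat_smult_left: "kronecker_mat (c \<cdot>\<^sub>m A) B = c \<cdot>\<^sub>m kronecker_mat A B"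
proof (rule eq_matI)
  fix i j assume ij: "i < dim_row (c \<cdot>\<^sub>m kronecker_mat A B)" "j < dim_col (c \<cdot>\<^sub>m kronecker_mat A B)"
  then have "i div dim_row B < dim_row A" "j div dim_col B < dim_col A"
    by (auto simp: kronecker_mat_def less_mult_imp_div_less)
  then show "kronecker_mat (c \<cdot>\<^sub>m A) B $$ (i, j) = (c \<cdot>\<^sub>m kronecker_mat A B) $$ (i, j)"
    using ij by (auto simp: kronecker_mat_def)
qed (auto simp: kronecker_mat_def)

lemma kronecker_mat_smult_right: "kronecker_mat A (c \<cdot>\<^sub>m B) = c \<cdot>\<^sub>m kronecker_mat A B"
proof (rule eq_matI)
  fix i j assume ij: "i < dim_row (c \<cdot>\<^sub>m kronecker_mat A B)" "j < dim_col (c \<cdot>\<^sub>m kronecker_mat A B)"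
  then have "i mod dim_row B < dim_row B" "j mod dim_col B < dim_col B"
    by (auto simp: kronecker_mat_def intro!: mod_less_divisor gr0I)
  then show "kronecker_mat A (c \<cdot>\<^sub>m B) $$ (i, j) = (c \<cdot>\<^sub>m kronecker_mat A B) $$ (i, j)"
    using ij by (auto simp: kronecker_mat_def)
qed (auto simp: kronecker_mat_def)

lemma mat_adjoint_carrier [simp]: "A \<in> carrier_mat a b \<Longrightarrow> mat_adjoint A \<in> carrier_mat b a"
  by (auto simp: mat_adjoint_def mat_of_rows_def)

lemma mat_adjoint_dim [simp]: "dim_row (mat_adjoint A) = dim_col A" "dim_col (mat_adjoint A) = dim_row A"
  by (auto simp: mat_adjoint_def mat_of_rows_def)

lemma mat_adjoint_index [simp]:
  fixes A :: "complex mat"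
  shows "i < dim_col A \<Longrightarrow> j < dim_row A \<Longrightarrow> mat_adjoint A $$ (i, j) = cnj (A $$ (j, i))"
  by (auto simp: mat_adjoint_def mat_of_rows_def conjugate_complex_def)

lemma mat_adjoint_mult:
  fixes A B :: "complex mat"
  assumes "A \<in> carrier_mat a b" "B \<in> carrier_mat b c"
  shows "mat_adjoint (A * B) = mat_adjoint B * mat_adjoint A"
  using assms by (intro eq_matI) (auto simp: scalar_prod_def mult.commute)

lemma mat_adjoint_smult: "mat_adjoint (c \<cdot>\<^sub>m A) = cnj c \<cdot>\<^sub>m mat_adjoint (A :: complex mat)"
  by (intro eq_matI) auto

lemma mat_adjoint_one [simp]: "mat_adjoint (1\<^sub>m N) = (1\<^sub>m N :: complex mat)"
  by (intro eq_matI) auto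

lemma mat_adjoint_kronecker: "mat_adjoint (kronecker_mat A B) = kronecker_mat (mat_adjoint A) (mat_adjoint B)"
proof (rule eq_matI)
  fix i j assume ij: "i < dim_row (kronecker_mat (mat_adjoint A) (mat_adjoint B))"
    "j < dim_col (kronecker_mat (mat_adjoint A) (mat_adjoint B))"
  then have "i mod dim_col B < dim_col B" "j mod dim_row B < dim_row B"
    "i div dim_col B < dim_col A" "j div dim_row B < dim_row A"
    by (auto simp: kronecker_mat_def less_mult_imp_div_less intro!: mod_less_divisor gr0I)
  then show "mat_adjoint (kronecker_mat A B) $$ (i, j) =
      kronecker_mat (mat_adjoint A) (mat_adjoint B) $$ (i, j)"
    using ij by (auto simp: kronecker_mat_def)
qed (auto simp: kronecker_mat_def)

section \<open>Pauli strings\<close>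

text \<open>Explicit arithmetic of two-by-two matrices, by which the Pauli multiplication table is a simplification.\<close>

lemma mat2_eq_iff:
  "mat_of_rows_list 2 [[a, b], [c, d]] = mat_of_rows_list 2 [[a', b'], [c', d']] \<longleftrightarrow>
    a = a' \<and> b = b' \<and> c = c' \<and> d = d'"
  by (auto simp: mat_of_rows_list_def mat_eq_iff less_Suc_eq numeral_2_eq_2)

lemma mat2_mult:
  "mat_of_rows_list 2 [[a, b], [c, d]] * mat_of_rows_list 2 [[a', b'], [c', d']] =
   mat_of_rows_list 2 [[a * a' + b * c', a * b' + b * d'], [c * a' + d * c', c * b' + d * (d' :: complex)]]"
  by (intro eq_matI)
    (auto simp: mat_of_rows_list_def scalar_prod_def less_Suc_eq numeral_2_eq_2)

lemma mat2_smult: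
  "k \<cdot>\<^sub>m mat_of_rows_list 2 [[a, b], [c, d]] = mat_of_rows_list 2 [[k * a, k * b], [k * c, k * (d :: complex)]]"
  by (intro eq_matI) (auto simp: mat_of_rows_list_def less_Suc_eq numeral_2_eq_2)

lemma mat2_one: "1\<^sub>m 2 = mat_of_rows_list 2 [[1, 0], [0, 1 :: complex]]"
  by (intro eq_matI) (auto simp: mat_of_rows_list_def less_Suc_eq numeral_2_eq_2)

lemma mat2_adjoint:
  "mat_adjoint (mat_of_rows_list 2 [[a, b], [c, d]]) = mat_of_rows_list 2 [[cnj a, cnj c], [cnj b, cnj d]]"
  by (intro eq_matI) (auto simp: mat_of_rows_list_def less_Suc_eq numeral_2_eq_2)

lemmas mat2_simps = pauli_X_def pauli_Y_def pauli_Z_def mat2_one mat2_mult mat2_smult mat2_adjoint mat2_eq_iff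

definition pauli_phases :: "complex set" where
  "pauli_phases = {1, - 1, \<i>, - \<i>}"

lemma pauli_phases_mult: "c \<in> pauli_phases \<Longrightarrow> d \<in> pauli_phases \<Longrightarrow> c * d \<in> pauli_phases"
  by (auto simp: pauli_phases_def)

lemma pauli_carrier: "\<sigma> \<in> pauli_matrices \<Longrightarrow> \<sigma> \<in> carrier_mat 2 2"
  by (auto simp: pauli_matrices_def pauli_X_def pauli_Y_def pauli_Z_def mat_of_rows_list_def)

lemma pauli_adjoint: "\<sigma> \<in> pauli_matrices \<Longrightarrow> mat_adjoint \<sigma> = \<sigma>"
  by (auto simp: pauli_matrices_def mat2_simps)

lemma pauli_square: "\<sigma> \<in> pauli_matrices \<Longrightarrow> \<sigma> * \<sigma> = 1\<^sub>m 2"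
  by (auto simp: pauli_matrices_def mat2_simps)

lemma pauli_commute_cases:
  "\<sigma> \<in> pauli_matrices \<Longrightarrow> \<tau> \<in> pauli_matrices \<Longrightarrow> \<exists>s\<in>{1, - 1}. \<sigma> * \<tau> = s \<cdot>\<^sub>m (\<tau> * \<sigma>)"
  by (auto simp: pauli_matrices_def mat2_simps)

lemma pauli_mult:
  "\<sigma> \<in> pauli_matrices \<Longrightarrow> \<tau> \<in> pauli_matrices \<Longrightarrow>
    \<exists>c\<in>pauli_phases. \<exists>\<rho>\<in>pauli_matrices. \<sigma> * \<tau> = c \<cdot>\<^sub>m \<rho>"
  unfolding pauli_matrices_def pauli_phases_def
  by (elim insertE emptyE; simp add: mat2_simps)

lemma pauli_strings_0: "pauli_strings 0 = {1\<^sub>m 1}"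
  by (auto simp: pauli_strings_def)

lemma pauli_strings_Suc:
  "pauli_strings (Suc n) = {kronecker_mat \<sigma> S | \<sigma> S. \<sigma> \<in> pauli_matrices \<and> S \<in> pauli_strings n}"
proof (intro equalityI subsetI)
  fix T assume "T \<in> pauli_strings (Suc n)"
  then obtain \<sigma>s where \<sigma>s: "T = foldr kronecker_mat \<sigma>s (1\<^sub>m 1)" "length \<sigma>s = Suc n" "set \<sigma>s \<subseteq> pauli_matrices"
    by (auto simp: pauli_strings_def)
  then obtain \<sigma> \<tau>s where "\<sigma>s = \<sigma> # \<tau>s"
    by (cases \<sigma>s) auto
  with \<sigma>s show "T \<in> {kronecker_mat \<sigma> S | \<sigma> S. \<sigma> \<in> pauli_matrices \<and> S \<in> pauli_strings n}"
    unfolding pauli_strings_def by auto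
next
  fix T assume "T \<in> {kronecker_mat \<sigma> S | \<sigma> S. \<sigma> \<in> pauli_matrices \<and> S \<in> pauli_strings n}"
  then obtain \<sigma> \<tau>s where "T = foldr kronecker_mat (\<sigma> # \<tau>s) (1\<^sub>m 1)" "\<sigma> \<in> pauli_matrices"
    "length \<tau>s = n" "set \<tau>s \<subseteq> pauli_matrices"
    by (auto simp: pauli_strings_def)
  then show "T \<in> pauli_strings (Suc n)"
    unfolding pauli_strings_def by (intro CollectI exI[of _ "\<sigma> # \<tau>s"]) auto
qed

lemma pauli_string_carrier: "S \<in> pauli_strings n \<Longrightarrow> S \<in> carrier_mat (2 ^ n) (2 ^ n)"
  by (induction n arbitrary: S)
    (auto simp: pauli_strings_0 pauli_strings_Suc intro!: kronecker_mat_carrier pauli_carrier)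

lemma finite_pauli_strings: "finite (pauli_strings n)"
proof (induction n)
  case (Suc n)
  have "pauli_strings (Suc n) = (\<lambda>(\<sigma>, S). kronecker_mat \<sigma> S) ` (pauli_matrices \<times> pauli_strings n)"
    by (auto simp: pauli_strings_Suc)
  then show ?case
    using Suc by (auto simp: pauli_matrices_def)
qed (simp add: pauli_strings_0)

lemma pauli_string_adjoint: "S \<in> pauli_strings n \<Longrightarrow> mat_adjoint S = S"
  by (induction n arbitrary: S)
    (auto simp: pauli_strings_0 pauli_strings_Suc mat_adjoint_kronecker pauli_adjoint)

lemma pauli_string_square: "S \<in> pauli_strings n \<Longrightarrow> S * S = 1\<^sub>m (2 ^ n)"
proof (induction n arbitrary: S)
  case (Suc n)
  then obtain \<sigma> T where "S = kronecker_mat \<sigma> T" "\<sigma> \<in> pauli_matrices" "T \<in> pauli_strings n"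
    by (auto simp: pauli_strings_Suc)
  then show ?case
    by (simp add: kronecker_mat_mult[OF pauli_carrier pauli_carrier pauli_string_carrier
          pauli_string_carrier] pauli_square Suc.IH kronecker_mat_one)
qed (auto simp: pauli_strings_0)

lemma pauli_string_commute_cases:
  "S \<in> pauli_strings n \<Longrightarrow> T \<in> pauli_strings n \<Longrightarrow> \<exists>s\<in>{1, - 1}. S * T = s \<cdot>\<^sub>m (T * S)"
proof (induction n arbitrary: S T)
  case (Suc n)
  obtain \<sigma> S' \<tau> T' where *: "S = kronecker_mat \<sigma> S'" "T = kronecker_mat \<tau> T'"
    "\<sigma> \<in> pauli_matrices" "\<tau> \<in> pauli_matrices" "S' \<in> pauli_strings n" "T' \<in> pauli_strings n"
    using Suc.prems by (auto simp: pauli_strings_Suc)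
  obtain s s' where s: "s \<in> {1, - 1}" "\<sigma> * \<tau> = s \<cdot>\<^sub>m (\<tau> * \<sigma>)" "s' \<in> {1, - 1}" "S' * T' = s' \<cdot>\<^sub>m (T' * S')"
    using Suc.IH[OF *(5,6)] pauli_commute_cases[OF *(3,4)] by auto
  have "S * T = (s * s') \<cdot>\<^sub>m (T * S)"
    using * s by (simp add: kronecker_mat_mult[OF pauli_carrier pauli_carrier pauli_string_carrier
          pauli_string_carrier] kronecker_mat_smult_left kronecker_mat_smult_right smult_smult_mat mult.commute)
  moreover have "s * s' \<in> {1, - 1}"
    using s by auto
  ultimately show ?case
    by blast
qed (auto simp: pauli_strings_0)

lemma pauli_string_mult:
  "S \<in> pauli_strings n \<Longrightarrow> T \<in> pauli_strings n \<Longrightarrow>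
    \<exists>c\<in>pauli_phases. \<exists>R\<in>pauli_strings n. S * T = c \<cdot>\<^sub>m R"
proof (induction n arbitrary: S T)
  case (Suc n)
  obtain \<sigma> S' \<tau> T' where *: "S = kronecker_mat \<sigma> S'" "T = kronecker_mat \<tau> T'"
    "\<sigma> \<in> pauli_matrices" "\<tau> \<in> pauli_matrices" "S' \<in> pauli_strings n" "T' \<in> pauli_strings n"
    using Suc.prems by (auto simp: pauli_strings_Suc)
  obtain c \<rho> where c: "c \<in> pauli_phases" "\<rho> \<in> pauli_matrices" "\<sigma> * \<tau> = c \<cdot>\<^sub>m \<rho>"
    using pauli_mult[OF *(3,4)] by auto
  obtain d R where d: "d \<in> pauli_phases" "R \<in> pauli_strings n" "S' * T' = d \<cdot>\<^sub>m R"
    using Suc.IH[OF *(5,6)] by auto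
  have "S * T = (c * d) \<cdot>\<^sub>m kronecker_mat \<rho> R"
    using * c d by (simp add: kronecker_mat_mult[OF pauli_carrier pauli_carrier pauli_string_carrier
          pauli_string_carrier] kronecker_mat_smult_left kronecker_mat_smult_right smult_smult_mat mult.commute)
  then show ?case
    using c d pauli_phases_mult by (auto simp: pauli_strings_Suc)
qed (auto simp: pauli_strings_0 pauli_phases_def)

section \<open>Single-site Pauli matrices and their commutant\<close>

text \<open>The matrix \<open>\<sigma>\<close> on qubit \<open>j\<close> (counted from 0) and the identity on the other ones. For \<open>j \<ge> n\<close> this is the identity.\<close>

fun site :: "nat \<Rightarrow> nat \<Rightarrow> complex mat \<Rightarrow> complex mat" where
  "site 0 j \<sigma> = 1\<^sub>m 1"
| "site (Suc n) 0 \<sigma> = kronecker_mat \<sigma> (1\<^sub>m (2 ^ n))"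
| "site (Suc n) (Suc j) \<sigma> = kronecker_mat (1\<^sub>m 2) (site n j \<sigma>)"

lemma one_mem_pauli_strings: "1\<^sub>m (2 ^ n) \<in> pauli_strings n"
proof (induction n)
  case (Suc n)
  have "1\<^sub>m (2 ^ Suc n) = kronecker_mat (1\<^sub>m 2) (1\<^sub>m (2 ^ n))"
    by (simp add: kronecker_mat_one)
  then show ?case
    unfolding pauli_strings_Suc using Suc by (auto simp: pauli_matrices_def)
qed (simp add: pauli_strings_0)

lemma site_mem_pauli_strings: "\<sigma> \<in> pauli_matrices \<Longrightarrow> site n j \<sigma> \<in> pauli_strings n"
proof (induction n j \<sigma> rule: site.induct)
  case (3 n j \<sigma>)
  then show ?case
    by (auto simp: pauli_strings_Suc pauli_matrices_def)
next
  case (2 n \<sigma>)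
  then show ?case
    using one_mem_pauli_strings by (auto simp: pauli_strings_Suc)
qed (simp add: pauli_strings_0)

lemma site_carrier: "\<sigma> \<in> carrier_mat 2 2 \<Longrightarrow> site n j \<sigma> \<in> carrier_mat (2 ^ n) (2 ^ n)"
  by (induction n j \<sigma> rule: site.induct) (auto intro!: kronecker_mat_carrier)

lemma site_mult:
  "\<sigma> \<in> carrier_mat 2 2 \<Longrightarrow> \<tau> \<in> carrier_mat 2 2 \<Longrightarrow> site n j \<sigma> * site n j \<tau> = site n j (\<sigma> * \<tau>)"
proof (induction n arbitrary: j)
  case (Suc n)
  show ?case
  proof (cases j)
    case 0
    then show ?thesis
      using Suc.prems by (simp add: kronecker_mat_mult[where M = "2 ^ n"])
  next
    case (Suc i)
    then show ?thesis
      using Suc.prems Suc.IH[of i] by (simp add: kronecker_mat_mult[where M = "2 ^ n"] site_carrier)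
  qed
qed simp

lemma site_smult: "j < n \<Longrightarrow> site n j (c \<cdot>\<^sub>m \<sigma>) = c \<cdot>\<^sub>m site n j \<sigma>"
  by (induction n j \<sigma> rule: site.induct)
    (auto simp: kronecker_mat_smult_left kronecker_mat_smult_right)

lemma site_one: "site n j (1\<^sub>m 2) = 1\<^sub>m (2 ^ n)"
  by (induction n j "1\<^sub>m 2 :: complex mat" rule: site.induct) (auto simp: kronecker_mat_one)

lemma site_commute:
  "i \<noteq> j \<Longrightarrow> \<sigma> \<in> carrier_mat 2 2 \<Longrightarrow> \<tau> \<in> carrier_mat 2 2 \<Longrightarrow>
    site n i \<sigma> * site n j \<tau> = site n j \<tau> * site n i \<sigma>"
proof (induction n arbitrary: i j)
  case (Suc n)
  then show ?case
    by (cases i; cases j)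
      (auto simp: kronecker_mat_mult[where M = "2 ^ n"] site_carrier left_mult_one_mat[OF site_carrier]
        right_mult_one_mat[OF site_carrier])
qed simp

lemma four_block_mat_inject:
  assumes eq: "four_block_mat A B C D = four_block_mat A' B' C' D'"
    and "A \<in> carrier_mat M M" "B \<in> carrier_mat M M" "C \<in> carrier_mat M M" "D \<in> carrier_mat M M"
    and "A' \<in> carrier_mat M M" "B' \<in> carrier_mat M M" "C' \<in> carrier_mat M M" "D' \<in> carrier_mat M M"
  shows "A = A'" "B = B'" "C = C'" "D = D'"
proof -
  have entry: "four_block_mat A B C D $$ (i, j) = four_block_mat A' B' C' D' $$ (i, j)" for i j
    using eq by simp
  show "A = A'"
  proof (rule eq_matI)
    show "A $$ (i, j) = A' $$ (i, j)" if "i < dim_row A'" "j < dim_col A'" for i j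
      using that assms(2-) entry[of i j] by auto
  qed (use assms in auto)
  show "B = B'"
  proof (rule eq_matI)
    show "B $$ (i, j) = B' $$ (i, j)" if "i < dim_row B'" "j < dim_col B'" for i j
      using that assms(2-) entry[of i "j + M"] by auto
  qed (use assms in auto)
  show "C = C'"
  proof (rule eq_matI)
    show "C $$ (i, j) = C' $$ (i, j)" if "i < dim_row C'" "j < dim_col C'" for i j
      using that assms(2-) entry[of "i + M" j] by auto
  qed (use assms in auto)
  show "D = D'"
  proof (rule eq_matI)
    show "D $$ (i, j) = D' $$ (i, j)" if "i < dim_row D'" "j < dim_col D'" for i j
      using that assms(2-) entry[of "i + M" "j + M"] by auto
  qed (use assms in auto)
qed

text \<open>In two-by-two block form, commuting with \<open>Z\<close> on the first qubit forces the off-diagonal blocks to vanish,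
  and commuting with \<open>X\<close> there forces the two diagonal blocks to agree; the common block then commutes with all
  \<open>X\<close> and \<open>Z\<close> on the remaining qubits.\<close>

lemma commutant_of_sites:
  assumes "M \<in> carrier_mat (2 ^ n) (2 ^ n)"
    and "\<And>j \<sigma>. j < n \<Longrightarrow> \<sigma> \<in> {pauli_X, pauli_Z} \<Longrightarrow> M * site n j \<sigma> = site n j \<sigma> * M"
  shows "\<exists>c. M = c \<cdot>\<^sub>m 1\<^sub>m (2 ^ n)"
  using assms
proof (induction n arbitrary: M)
  case 0
  then have "M = M $$ (0, 0) \<cdot>\<^sub>m 1\<^sub>m (2 ^ 0)"
    by (intro eq_matI) auto
  then show ?case ..
next
  case (Suc n)
  let ?N = "2 ^ n :: nat"
  obtain A B C D where split: "split_block M ?N ?N = (A, B, C, D)"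
    by (metis prod_cases4)
  have dims: "dim_row M = ?N + ?N" "dim_col M = ?N + ?N"
    using Suc.prems(1) by auto
  note blocks = split_block[OF split dims]
  have site0: "site (Suc n) 0 \<sigma> = four_block_mat (\<sigma> $$ (0, 0) \<cdot>\<^sub>m 1\<^sub>m ?N) (\<sigma> $$ (0, 1) \<cdot>\<^sub>m 1\<^sub>m ?N)
      (\<sigma> $$ (1, 0) \<cdot>\<^sub>m 1\<^sub>m ?N) (\<sigma> $$ (1, 1) \<cdot>\<^sub>m 1\<^sub>m ?N)" if "\<sigma> \<in> pauli_matrices" for \<sigma>
    by (simp add: kronecker_mat_four_block[OF pauli_carrier[OF that], where M = ?N])
  have XZ: "pauli_X \<in> pauli_matrices" "pauli_Z \<in> pauli_matrices"
    by (auto simp: pauli_matrices_def)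
  have smult_one: "A' * (c \<cdot>\<^sub>m 1\<^sub>m ?N) = c \<cdot>\<^sub>m A'" "(c \<cdot>\<^sub>m 1\<^sub>m ?N) * A' = c \<cdot>\<^sub>m A'"
    if "A' \<in> carrier_mat ?N ?N" for A' :: "complex mat" and c
    using that by (simp_all add: mult_smult_distrib[of _ ?N ?N _ ?N] mult_smult_assoc_mat[of _ ?N ?N _ ?N])
  have add0: "A' + 0 \<cdot>\<^sub>m B' = A'" "0 \<cdot>\<^sub>m B' + A' = A'" if "A' \<in> carrier_mat ?N ?N" "B' \<in> carrier_mat ?N ?N"
    for A' B' :: "complex mat"
    using that by (auto intro!: eq_matI)
  have "M * site (Suc n) 0 pauli_Z = site (Suc n) 0 pauli_Z * M"
    using Suc.prems(2)[of 0] by blast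
  then have "four_block_mat A ((-1) \<cdot>\<^sub>m B) C ((-1) \<cdot>\<^sub>m D) = four_block_mat A B ((-1) \<cdot>\<^sub>m C) ((-1) \<cdot>\<^sub>m D)"
    unfolding blocks(5) site0[OF XZ(2)] using blocks(1-4)
    by (simp add: mult_four_block_mat[of _ ?N ?N _ ?N _ ?N _ _ ?N _ ?N] smult_one add0 one_smult_mat
        pauli_Z_def mat_of_rows_list_def)
  note Z = four_block_mat_inject[OF this, of ?N]
  have self_neg: "A' = 0\<^sub>m ?N ?N" if "A' \<in> carrier_mat ?N ?N" "(-1) \<cdot>\<^sub>m A' = A'" for A' :: "complex mat"
  proof (rule eq_matI)
    fix i j assume ij: "i < dim_row (0\<^sub>m ?N ?N :: complex mat)" "j < dim_col (0\<^sub>m ?N ?N :: complex mat)"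
    moreover have "((-1) \<cdot>\<^sub>m A') $$ (i, j) = A' $$ (i, j)"
      by (simp only: that(2))
    ultimately have "- (A' $$ (i, j)) = A' $$ (i, j)"
      using that(1) by simp
    then have "2 * A' $$ (i, j) = 0"
      by (metis add.right_inverse mult_2)
    then show "A' $$ (i, j) = 0\<^sub>m ?N ?N $$ (i, j)"
      using ij by simp
  qed (use that in auto)
  have BC: "B = 0\<^sub>m ?N ?N" "C = 0\<^sub>m ?N ?N"
    using Z blocks(1-4) by (auto intro!: self_neg)
  have "M * site (Suc n) 0 pauli_X = site (Suc n) 0 pauli_X * M"
    using Suc.prems(2)[of 0] by blast
  then have "four_block_mat B A D C = four_block_mat C D A B"
    unfolding blocks(5) site0[OF XZ(1)] using blocks(1-4)
    by (simp add: mult_four_block_mat[of _ ?N ?N _ ?N _ ?N _ _ ?N _ ?N] smult_one add0 one_smult_mat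
        pauli_X_def mat_of_rows_list_def)
  then have "A = D"
    using four_block_mat_inject[of B A D C C D A B ?N] blocks(1-4) by simp
  then have M: "M = four_block_mat A (0\<^sub>m ?N ?N) (0\<^sub>m ?N ?N) A"
    using blocks(5) BC by simp
  have "A * site n j \<sigma> = site n j \<sigma> * A" if "j < n" "\<sigma> \<in> {pauli_X, pauli_Z}" for j \<sigma>
  proof -
    have \<sigma>: "\<sigma> \<in> pauli_matrices"
      using that by (auto simp: pauli_matrices_def)
    let ?S = "site n j \<sigma>"
    have S: "?S \<in> carrier_mat ?N ?N"
      using \<sigma> by (simp add: pauli_carrier site_carrier)
    have "site (Suc n) (Suc j) \<sigma> = four_block_mat ?S (0\<^sub>m ?N ?N) (0\<^sub>m ?N ?N) ?S"
      using S by (simp add: kronecker_mat_four_block[where M = ?N])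
        (rule cong_four_block_mat; auto intro!: eq_matI)
    moreover have "M * site (Suc n) (Suc j) \<sigma> = site (Suc n) (Suc j) \<sigma> * M"
      using Suc.prems(2)[of "Suc j" \<sigma>] that by simp
    ultimately have "four_block_mat (A * ?S) (0\<^sub>m ?N ?N) (0\<^sub>m ?N ?N) (A * ?S) =
        four_block_mat (?S * A) (0\<^sub>m ?N ?N) (0\<^sub>m ?N ?N) (?S * A)"
      unfolding M using blocks(1) S by (simp add: mult_four_block_mat[of _ ?N ?N _ ?N _ ?N _ _ ?N _ ?N])
    then show ?thesis
      by (rule four_block_mat_inject(1)[where M = ?N]) (use blocks(1) S in auto)
  qed
  then obtain c where "A = c \<cdot>\<^sub>m 1\<^sub>m ?N"
    using Suc.IH[OF blocks(1)] by blast
  then have "M = c \<cdot>\<^sub>m 1\<^sub>m (2 ^ Suc n)"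
    unfolding M by (intro eq_matI) auto
  then show ?case ..
qed

section \<open>Square matrices and signed commutation\<close>

lemma square_mat_algebra:
  fixes A B C :: "complex mat" and N :: nat
  defines "M \<equiv> carrier_mat N N"
  shows "\<lbrakk>A \<in> M; B \<in> M; C \<in> M\<rbrakk> \<Longrightarrow> (A + B) * C = A * C + B * C"
    "\<lbrakk>A \<in> M; B \<in> M; C \<in> M\<rbrakk> \<Longrightarrow> C * (A + B) = C * A + C * B"
    "\<lbrakk>A \<in> M; B \<in> M\<rbrakk> \<Longrightarrow> (c \<cdot>\<^sub>m A) * B = c \<cdot>\<^sub>m (A * B)"
    "\<lbrakk>A \<in> M; B \<in> M\<rbrakk> \<Longrightarrow> A * (c \<cdot>\<^sub>m B) = c \<cdot>\<^sub>m (A * B)"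
    "\<lbrakk>A \<in> M; B \<in> M\<rbrakk> \<Longrightarrow> c \<cdot>\<^sub>m (A + B) = c \<cdot>\<^sub>m A + c \<cdot>\<^sub>m B"
    "A \<in> M \<Longrightarrow> c \<cdot>\<^sub>m A \<in> M"
    "\<lbrakk>A \<in> M; B \<in> M\<rbrakk> \<Longrightarrow> A * B \<in> M"
    "\<lbrakk>A \<in> M; B \<in> M\<rbrakk> \<Longrightarrow> A + B \<in> M"
    "\<lbrakk>A \<in> M; B \<in> M; C \<in> M\<rbrakk> \<Longrightarrow> A * B * C = A * (B * C)"
    "A \<in> M \<Longrightarrow> A * 1\<^sub>m N = A" "A \<in> M \<Longrightarrow> 1\<^sub>m N * A = A" "1\<^sub>m N \<in> M"
  by (auto simp: M_def add_mult_distrib_mat[of _ N N _ _ N] mult_add_distrib_mat[of _ N N _ N]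
      add_smult_distrib_left_mat[of _ N N] mult_smult_assoc_mat[of _ N N _ N]
      mult_smult_distrib[of _ N N _ N])

text \<open>Conjugation is expressed by intertwining relations \<open>A * F = G * A\<close> throughout, which avoids inverses.\<close>

lemma intertwine_trans:
  assumes AF: "A * F = G * A" and EG: "E * G = F' * E"
    and carrier: "A \<in> carrier_mat N N" "E \<in> carrier_mat N N" "F \<in> carrier_mat N N"
      "F' \<in> carrier_mat N N" "G \<in> carrier_mat N N"
  shows "E * A * F = F' * (E * A)"
proof -
  note alg = square_mat_algebra[where N = N]
  have "E * A * F = E * (A * F)"
    using carrier by (simp add: alg)
  also have "\<dots> = E * G * A"
    unfolding AF using carrier by (simp add: alg)
  also have "\<dots> = F' * (E * A)"
    unfolding EG using carrier by (simp add: alg)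
  finally show ?thesis .
qed

text \<open>The sign \<open>s\<close> is \<open>1\<close> for commuting and \<open>- 1\<close> for anticommuting operators; a common notion for both makes the sign of a
  product the product of the signs.\<close>

definition commute_up_to :: "complex \<Rightarrow> complex mat \<Rightarrow> complex mat \<Rightarrow> bool" where
  "commute_up_to s P Q \<longleftrightarrow> P * Q = s \<cdot>\<^sub>m (Q * P)"

lemma commute_up_to_1: "commute_up_to 1 P Q \<longleftrightarrow> P * Q = Q * P"
  by (simp add: commute_up_to_def one_smult_mat)

lemma commute_up_to_smult:
  assumes "commute_up_to s P Q" "P \<in> carrier_mat N N" "Q \<in> carrier_mat N N"
  shows "commute_up_to s P (c \<cdot>\<^sub>m Q)"
  using assms by (simp add: commute_up_to_def square_mat_algebra[where N = N] smult_smult_mat mult.commute)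

lemma commute_up_to_mult:
  assumes PQ: "commute_up_to s P Q" and PR: "commute_up_to t P R"
    and carrier: "P \<in> carrier_mat N N" "Q \<in> carrier_mat N N" "R \<in> carrier_mat N N"
  shows "commute_up_to (s * t) P (Q * R)"
proof -
  note alg = square_mat_algebra[where N = N]
  have "P * (Q * R) = P * Q * R"
    using carrier by (simp add: alg)
  also have "\<dots> = s \<cdot>\<^sub>m (Q * (P * R))"
    using PQ carrier by (simp add: commute_up_to_def alg)
  also have "\<dots> = (s * t) \<cdot>\<^sub>m (Q * R * P)"
    using PR carrier by (simp add: commute_up_to_def alg smult_smult_mat)
  finally show ?thesis
    by (simp add: commute_up_to_def)
qed

lemma commute_up_to_sym: "commute_up_to s P Q \<Longrightarrow> s \<in> {1, - 1} \<Longrightarrow> commute_up_to s Q P"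
  by (auto simp: commute_up_to_def smult_smult_mat one_smult_mat)

section \<open>The unitary group\<close>

lemma unitary_group_simps [simp]:
  "monoid.mult (unitary_group N) = (*)" "one (unitary_group N) = 1\<^sub>m N"
  by (auto simp: unitary_group_def)

lemma unitary_carrier_iff:
  "A \<in> carrier (unitary_group N) \<longleftrightarrow> A \<in> carrier_mat N N \<and> mat_adjoint A * A = 1\<^sub>m N"
  by (auto simp: unitary_group_def)

lemma unitary_carrier_mat: "A \<in> carrier (unitary_group N) \<Longrightarrow> A \<in> carrier_mat N N"
  by (simp add: unitary_carrier_iff)

lemma unitary_adjoint_right:
  "A \<in> carrier (unitary_group N) \<Longrightarrow> A * mat_adjoint A = 1\<^sub>m N"
  by (auto simp: unitary_carrier_iff intro: mat_mult_left_right_inverse)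

lemma mat_adjoint_adjoint [simp]: "mat_adjoint (mat_adjoint A) = (A :: complex mat)"
  by (intro eq_matI) auto

lemma unitary_adjoint: "A \<in> carrier (unitary_group N) \<Longrightarrow> mat_adjoint A \<in> carrier (unitary_group N)"
  using unitary_adjoint_right by (simp add: unitary_carrier_iff)

lemma unitary_mult:
  assumes "A \<in> carrier (unitary_group N)" "B \<in> carrier (unitary_group N)"
  shows "A * B \<in> carrier (unitary_group N)"
proof -
  note alg = square_mat_algebra[where N = N]
  have c: "A \<in> carrier_mat N N" "B \<in> carrier_mat N N" "mat_adjoint A * A = 1\<^sub>m N" "mat_adjoint B * B = 1\<^sub>m N"
    using assms by (auto simp: unitary_carrier_iff)
  have "mat_adjoint (A * B) * (A * B) = mat_adjoint B * (mat_adjoint A * A * B)"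
    using c(1,2) by (simp add: mat_adjoint_mult[where a = N and b = N and c = N] alg)
  also have "\<dots> = 1\<^sub>m N"
    using c by simp
  finally show ?thesis
    using c by (simp add: unitary_carrier_iff alg)
qed

lemma unitary_one: "1\<^sub>m N \<in> carrier (unitary_group N)"
  by (simp add: unitary_carrier_iff)

lemma group_unitary_group: "group (unitary_group N)"
proof (rule groupI)
  show "\<exists>B\<in>carrier (unitary_group N). B \<otimes>\<^bsub>unitary_group N\<^esub> A = \<one>\<^bsub>unitary_group N\<^esub>"
    if "A \<in> carrier (unitary_group N)" for A
    using that unitary_adjoint[OF that] by (auto simp: unitary_carrier_iff)
qed (auto simp: unitary_mult unitary_one square_mat_algebra[where N = N] unitary_carrier_mat)

lemma unitary_inv: "A \<in> carrier (unitary_group N) \<Longrightarrow> inv\<^bsub>unitary_group N\<^esub> A = mat_adjoint A"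
  using group.inv_equality[OF group_unitary_group, of N "mat_adjoint A" A] unitary_adjoint[of A N]
  by (simp add: unitary_carrier_iff)

lemma unitary_smult:
  assumes "A \<in> carrier (unitary_group N)" "cmod c = 1"
  shows "c \<cdot>\<^sub>m A \<in> carrier (unitary_group N)"
proof -
  have "cnj c * c = 1"
    using assms(2) complex_norm_square[of c] by (simp add: mult.commute)
  then show ?thesis
    using assms by (auto simp: unitary_carrier_iff mat_adjoint_smult smult_smult_mat
        square_mat_algebra[where N = N] one_smult_mat mult.commute)
qed

lemma cmod_unitary_scalar:
  assumes "c \<cdot>\<^sub>m 1\<^sub>m N \<in> carrier (unitary_group N)" "0 < N"
  shows "cmod c = 1"
proof -
  have "(cnj c * c) \<cdot>\<^sub>m 1\<^sub>m N = (1\<^sub>m N :: complex mat)"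
    using assms(1)
    by (simp add: unitary_carrier_iff mat_adjoint_smult square_mat_algebra[where N = N] smult_smult_mat mult.commute)
  then have "((cnj c * c) \<cdot>\<^sub>m 1\<^sub>m N) $$ (0, 0) = (1\<^sub>m N :: complex mat) $$ (0, 0)"
    by (rule arg_cong)
  then have "cnj c * c = 1"
    using assms(2) by simp
  then have "(cmod c)\<^sup>2 = 1"
    using complex_norm_square[of c] by (metis mult.commute of_real_eq_1_iff)
  then show ?thesis
    by (simp add: power2_eq_1_iff) (smt (verit) norm_ge_zero)
qed

lemma unitary_cancel_right:
  assumes eq: "B * A = C * A" and A: "A \<in> carrier (unitary_group N)"
    and BC: "B \<in> carrier_mat N N" "C \<in> carrier_mat N N"
  shows "B = C"
proof -
  note alg = square_mat_algebra[where N = N]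
  have "B = B * A * mat_adjoint A" "C = C * A * mat_adjoint A"
    using A BC unitary_adjoint_right[OF A] by (simp_all add: alg unitary_carrier_iff)
  then show ?thesis
    using eq by simp
qed

lemma unitary_not_self_negative:
  assumes M: "M \<in> carrier (unitary_group N)" and neg: "M = (-1) \<cdot>\<^sub>m M" and "0 < N"
  shows False
proof -
  have "1\<^sub>m N = (-1) \<cdot>\<^sub>m (mat_adjoint M * M)"
    using M by (subst square_mat_algebra(4)[symmetric, where N = N]) (auto simp: unitary_carrier_iff neg[symmetric])
  also have "\<dots> = (-1) \<cdot>\<^sub>m 1\<^sub>m N"
    using M by (simp add: unitary_carrier_iff)
  finally have "(1\<^sub>m N :: complex mat) $$ (0, 0) = ((-1) \<cdot>\<^sub>m 1\<^sub>m N) $$ (0, 0)"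
    by (rule arg_cong)
  then show False
    using \<open>0 < N\<close> by simp
qed

lemma not_commute_and_anticommute:
  assumes "P \<in> carrier (unitary_group N)" "Q \<in> carrier (unitary_group N)" "0 < N"
    and "commute_up_to (-1) P Q"
  shows "\<not> commute_up_to 1 P Q"
  using unitary_not_self_negative[OF unitary_mult[OF assms(1,2)] _ assms(3)] assms(4)
  by (auto simp: commute_up_to_def one_smult_mat smult_smult_mat)

lemma commute_up_to_conjugate:
  assumes comm: "commute_up_to s P Q" and P: "A * P = P' * A" and Q: "A * Q = Q' * A"
    and A: "A \<in> carrier (unitary_group N)"
    and carrier: "P \<in> carrier_mat N N" "Q \<in> carrier_mat N N" "P' \<in> carrier_mat N N" "Q' \<in> carrier_mat N N"
  shows "commute_up_to s P' Q'"
proof -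
  note alg = square_mat_algebra[where N = N]
  have move: "X' * Y' * A = A * (X * Y)"
    if "A * X = X' * A" "A * Y = Y' * A" "X \<in> carrier_mat N N" "Y \<in> carrier_mat N N"
      "X' \<in> carrier_mat N N" "Y' \<in> carrier_mat N N" for X Y X' Y'
  proof -
    note assoc = assoc_mult_mat[of _ N N _ N _ N]
    have "X' * Y' * A = X' * (A * Y)"
      unfolding that(2) using that(3-6) unitary_carrier_mat[OF A] by (simp add: assoc)
    also have "\<dots> = A * X * Y"
      using that(3-6) unitary_carrier_mat[OF A] by (simp add: assoc[symmetric] that(1) del: assoc_mult_mat)
    also have "\<dots> = A * (X * Y)"
      using that(3-6) unitary_carrier_mat[OF A] by (simp add: assoc)
    finally show ?thesis .
  qed
  have "P' * Q' * A = s \<cdot>\<^sub>m (A * (Q * P))"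
    unfolding move[OF P Q carrier] using comm carrier unitary_carrier_mat[OF A]
    by (simp add: commute_up_to_def alg)
  also have "\<dots> = (s \<cdot>\<^sub>m (Q' * P')) * A"
    unfolding move[OF Q P carrier(2,1,4,3), symmetric] using carrier unitary_carrier_mat[OF A]
    by (simp add: alg)
  finally have "P' * Q' * A = (s \<cdot>\<^sub>m (Q' * P')) * A" .
  then show ?thesis
    unfolding commute_up_to_def by (rule unitary_cancel_right[OF _ A]) (use carrier in \<open>simp_all add: alg\<close>)
qed

section \<open>The Pauli group\<close>

lemma pauli_string_unitary: "S \<in> pauli_strings n \<Longrightarrow> S \<in> carrier (unitary_group (2 ^ n))"
  by (simp add: unitary_carrier_iff pauli_string_carrier pauli_string_adjoint pauli_string_square)

lemma pauli_group_cases: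
  assumes "P \<in> pauli_group n"
  obtains c S where "c \<in> pauli_phases" "S \<in> pauli_strings n" "P = c \<cdot>\<^sub>m S"
proof -
  note alg = square_mat_algebra[where N = "2 ^ n"]
  have "\<exists>c\<in>pauli_phases. \<exists>S\<in>pauli_strings n. P = c \<cdot>\<^sub>m S"
    using assms unfolding pauli_group_def
  proof induction
    case one
    show ?case
      using one_mem_pauli_strings[of n]
      by (auto simp: pauli_phases_def one_smult_mat intro!: bexI[of _ "1\<^sub>m (2 ^ n)"])
  next
    case (incl h)
    then show ?case
      by (auto simp: pauli_phases_def one_smult_mat intro!: bexI[of _ h])
  next
    case (inv h)
    then have "inv\<^bsub>unitary_group (2 ^ n)\<^esub> h = h"
      by (simp add: unitary_inv pauli_string_unitary pauli_string_adjoint)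
    then show ?case
      using inv by (auto simp: pauli_phases_def one_smult_mat intro!: bexI[of _ h])
  next
    case (eng g h)
    then obtain c S d T where *: "c \<in> pauli_phases" "S \<in> pauli_strings n" "g = c \<cdot>\<^sub>m S"
      "d \<in> pauli_phases" "T \<in> pauli_strings n" "h = d \<cdot>\<^sub>m T"
      by blast
    obtain e R where R: "e \<in> pauli_phases" "R \<in> pauli_strings n" "S * T = e \<cdot>\<^sub>m R"
      using pauli_string_mult[OF *(2,5)] by blast
    have "g * h = (c * d * e) \<cdot>\<^sub>m R"
      using * R by (simp add: alg pauli_string_carrier smult_smult_mat mult.commute mult.left_commute)
    then show ?case
      using * R by (auto intro!: pauli_phases_mult bexI[of _ "c * d * e"] bexI[of _ R])
  qed
  then show ?thesis
    using that by blast
qed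

lemma pauli_group_subgroup: "subgroup (pauli_group n) (unitary_group (2 ^ n))"
  unfolding pauli_group_def
  by (rule group.generate_is_subgroup[OF group_unitary_group]) (auto simp: pauli_string_unitary)

lemma pauli_group_unitary: "P \<in> pauli_group n \<Longrightarrow> P \<in> carrier (unitary_group (2 ^ n))"
  using subgroup.mem_carrier[OF pauli_group_subgroup] .

lemma pauli_group_carrier: "P \<in> pauli_group n \<Longrightarrow> P \<in> carrier_mat (2 ^ n) (2 ^ n)"
  by (simp add: pauli_group_unitary unitary_carrier_mat)

lemma pauli_group_mult: "P \<in> pauli_group n \<Longrightarrow> Q \<in> pauli_group n \<Longrightarrow> P * Q \<in> pauli_group n"
  using subgroup.m_closed[OF pauli_group_subgroup] by simp

lemma pauli_strings_subset_pauli_group: "pauli_strings n \<subseteq> pauli_group n"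
  by (auto simp: pauli_group_def intro: generate.incl)

lemma site_mem_pauli_group: "\<sigma> \<in> pauli_matrices \<Longrightarrow> site n j \<sigma> \<in> pauli_group n"
  using site_mem_pauli_strings pauli_strings_subset_pauli_group by blast

lemma finite_pauli_group: "finite (pauli_group n)"
proof (rule finite_subset)
  show "pauli_group n \<subseteq> (\<lambda>(c, S). c \<cdot>\<^sub>m S) ` (pauli_phases \<times> pauli_strings n)"
    by (auto elim!: pauli_group_cases)
qed (auto simp: pauli_phases_def finite_pauli_strings)

lemma pauli_group_smult:
  assumes "P \<in> pauli_group n" "c \<in> pauli_phases" "0 < n"
  shows "c \<cdot>\<^sub>m P \<in> pauli_group n"
proof -
  note alg = square_mat_algebra[where N = "2 ^ n"]
  let ?I = "1\<^sub>m (2 ^ n) :: complex mat"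
  have XYZ: "pauli_X \<in> pauli_matrices" "pauli_Y \<in> pauli_matrices" "pauli_Z \<in> pauli_matrices"
    by (auto simp: pauli_matrices_def)
  \<comment> \<open>The scalar \<open>\<i>\<close> belongs to the Pauli group as \<open>X Y Z = \<i>\<close>; with no qubit, the group is trivial.\<close>
  have "site n 0 pauli_X * site n 0 pauli_Y * site n 0 pauli_Z = site n 0 (pauli_X * pauli_Y * pauli_Z)"
    using XYZ by (simp add: site_mult pauli_carrier mult_carrier_mat[of _ 2 2 _ 2])
  also have "pauli_X * pauli_Y * pauli_Z = \<i> \<cdot>\<^sub>m 1\<^sub>m 2"
    by (simp add: mat2_simps)
  also have "site n 0 (\<i> \<cdot>\<^sub>m 1\<^sub>m 2) = \<i> \<cdot>\<^sub>m ?I"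
    using \<open>0 < n\<close> by (simp add: site_smult site_one)
  finally have i: "\<i> \<cdot>\<^sub>m ?I \<in> pauli_group n"
    using XYZ by (metis pauli_group_mult site_mem_pauli_group)
  have "(\<i> \<cdot>\<^sub>m ?I) * (\<i> \<cdot>\<^sub>m ?I) = (-1) \<cdot>\<^sub>m ?I" "(\<i> \<cdot>\<^sub>m ?I) * ((-1) \<cdot>\<^sub>m ?I) = (- \<i>) \<cdot>\<^sub>m ?I"
    by (simp_all add: alg smult_smult_mat)
  then have "c \<cdot>\<^sub>m ?I \<in> pauli_group n"
    using assms(2) i pauli_group_mult[OF i i] pauli_group_mult[OF i, of "(-1) \<cdot>\<^sub>m ?I"]
      subgroup.one_closed[OF pauli_group_subgroup[of n]]
    by (auto simp: pauli_phases_def one_smult_mat)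
  then have "(c \<cdot>\<^sub>m ?I) * P \<in> pauli_group n"
    using assms(1) by (rule pauli_group_mult)
  then show ?thesis
    using pauli_group_carrier[OF assms(1)] by (simp add: alg)
qed

lemma pauli_group_commute_cases:
  assumes "P \<in> pauli_group n" "Q \<in> pauli_group n"
  shows "commute_up_to 1 P Q \<or> commute_up_to (-1) P Q"
proof -
  note alg = square_mat_algebra[where N = "2 ^ n"]
  obtain c S d T where *: "S \<in> pauli_strings n" "P = c \<cdot>\<^sub>m S" "T \<in> pauli_strings n" "Q = d \<cdot>\<^sub>m T"
    using assms by (elim pauli_group_cases) blast
  obtain s where "s \<in> {1, - 1}" "S * T = s \<cdot>\<^sub>m (T * S)"
    using pauli_string_commute_cases[OF *(1,3)] by blast
  then have "P * Q = s \<cdot>\<^sub>m (Q * P)"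
    using * by (simp add: alg pauli_string_carrier smult_smult_mat mult.commute mult.left_commute)
  then show ?thesis
    using \<open>s \<in> _\<close> by (auto simp: commute_up_to_def)
qed

lemma pauli_group_square_cases:
  assumes "P \<in> pauli_group n"
  shows "P * P = 1\<^sub>m (2 ^ n) \<or> P * P = (-1) \<cdot>\<^sub>m 1\<^sub>m (2 ^ n)"
proof -
  note alg = square_mat_algebra[where N = "2 ^ n"]
  obtain c S where *: "c \<in> pauli_phases" "S \<in> pauli_strings n" "P = c \<cdot>\<^sub>m S"
    using assms by (elim pauli_group_cases)
  then have "P * P = (c * c) \<cdot>\<^sub>m 1\<^sub>m (2 ^ n)"
    by (simp add: alg pauli_string_carrier smult_smult_mat pauli_string_square)
  then show ?thesis
    using *(1) by (auto simp: pauli_phases_def one_smult_mat)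
qed

definition pauli_involutions :: "nat \<Rightarrow> complex mat set" where
  "pauli_involutions n = {P \<in> pauli_group n. P * P = 1\<^sub>m (2 ^ n)}"

lemma pauli_involutions_D:
  assumes "P \<in> pauli_involutions n"
  shows "P \<in> pauli_group n" "P * P = 1\<^sub>m (2 ^ n)" "P \<in> carrier_mat (2 ^ n) (2 ^ n)"
    "P \<in> carrier (unitary_group (2 ^ n))"
  using assms by (auto simp: pauli_involutions_def pauli_group_carrier pauli_group_unitary)

lemma pauli_strings_subset_involutions: "S \<in> pauli_strings n \<Longrightarrow> S \<in> pauli_involutions n"
  using pauli_strings_subset_pauli_group by (auto simp: pauli_involutions_def pauli_string_square)

lemma pauli_involution_smult: "P \<in> pauli_involutions n \<Longrightarrow> 0 < n \<Longrightarrow> (-1) \<cdot>\<^sub>m P \<in> pauli_involutions n"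
  using pauli_group_smult[of P n "-1"]
  by (simp add: pauli_involutions_def pauli_phases_def square_mat_algebra[where N = "2 ^ n"]
      pauli_group_carrier smult_smult_mat one_smult_mat)

text \<open>A Pauli operator squares to \<open>1\<close> or \<open>- 1\<close>; in the second case \<open>\<i>\<close> times it is an involution.\<close>

lemma pauli_phase_normalize:
  assumes P: "P \<in> pauli_group n" and "0 < n"
  obtains c where "c \<cdot>\<^sub>m P \<in> pauli_involutions n"
proof (cases "P * P = 1\<^sub>m (2 ^ n)")
  case True
  then show ?thesis
    using P that[of 1] by (simp add: pauli_involutions_def one_smult_mat)
next
  case False
  then have "(\<i> \<cdot>\<^sub>m P) * (\<i> \<cdot>\<^sub>m P) = 1\<^sub>m (2 ^ n)"
    using pauli_group_square_cases[OF P] pauli_group_carrier[OF P]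
    by (simp add: square_mat_algebra[where N = "2 ^ n"] smult_smult_mat one_smult_mat)
  then show ?thesis
    using that[of \<i>] pauli_group_smult[OF P, of \<i>] \<open>0 < n\<close>
    by (simp add: pauli_involutions_def pauli_phases_def)
qed

text \<open>If neither \<open>R1\<close> nor \<open>R2\<close> anticommutes with both \<open>P\<close> and \<open>Q\<close>, their product does. The last conclusion allows a choice of
  \<open>R\<close> that commutes with prescribed operators.\<close>

lemma common_anticommuter:
  assumes P: "P \<in> pauli_group n" and Q: "Q \<in> pauli_group n" and "0 < n"
    and R1: "R1 \<in> pauli_group n" "commute_up_to (-1) P R1"
    and R2: "R2 \<in> pauli_group n" "commute_up_to (-1) Q R2"
  obtains R where "R \<in> pauli_involutions n" "commute_up_to (-1) P R" "commute_up_to (-1) Q R"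
    "\<And>F. F \<in> carrier_mat (2 ^ n) (2 ^ n) \<Longrightarrow> commute_up_to 1 F R1 \<Longrightarrow> commute_up_to 1 F R2 \<Longrightarrow> commute_up_to 1 F R"
proof -
  let ?N = "2 ^ n :: nat"
  note carrier = pauli_group_carrier[OF P] pauli_group_carrier[OF Q]
    pauli_group_carrier[OF R1(1)] pauli_group_carrier[OF R2(1)]
  obtain S where S: "S \<in> pauli_group n" "commute_up_to (-1) P S" "commute_up_to (-1) Q S"
    "\<And>F. F \<in> carrier_mat ?N ?N \<Longrightarrow> commute_up_to 1 F R1 \<Longrightarrow> commute_up_to 1 F R2 \<Longrightarrow> commute_up_to 1 F S"
  proof -
    consider "commute_up_to (-1) Q R1" | "commute_up_to (-1) P R2"
      | "commute_up_to 1 Q R1" "commute_up_to 1 P R2"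
      using pauli_group_commute_cases[OF Q R1(1)] pauli_group_commute_cases[OF P R2(1)] by blast
    then show ?thesis
    proof cases
      case 1
      then show ?thesis using that[of R1] R1 by blast
    next
      case 2
      then show ?thesis using that[of R2] R2 by blast
    next
      case 3
      show ?thesis
      proof (rule that[of "R1 * R2"])
        show "commute_up_to (-1) P (R1 * R2)"
          using commute_up_to_mult[OF R1(2) 3(2)] carrier by simp
        show "commute_up_to (-1) Q (R1 * R2)"
          using commute_up_to_mult[OF 3(1) R2(2)] carrier by simp
        show "commute_up_to 1 F (R1 * R2)"
          if "F \<in> carrier_mat ?N ?N" "commute_up_to 1 F R1" "commute_up_to 1 F R2" for F
          using commute_up_to_mult[OF that(2,3,1) carrier(3,4)] by simp
      qed (simp add: pauli_group_mult R1 R2)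
    qed
  qed
  obtain c where c: "c \<cdot>\<^sub>m S \<in> pauli_involutions n"
    using pauli_phase_normalize[OF S(1) \<open>0 < n\<close>] .
  show ?thesis
    using that[OF c] S(2,3,4) commute_up_to_smult carrier pauli_group_carrier[OF S(1)] by blast
qed

section \<open>Clifford unitaries\<close>

lemma clifford_unitaries_iff:
  "A \<in> clifford_unitaries n \<longleftrightarrow>
    A \<in> carrier (unitary_group (2 ^ n)) \<and> (\<forall>\<sigma>\<in>pauli_group n. \<exists>\<tau>\<in>pauli_group n. A * \<sigma> = \<tau> * A)"
proof -
  note alg = square_mat_algebra[where N = "2 ^ n"]
  have "A * \<sigma> * mat_adjoint A \<in> pauli_group n \<longleftrightarrow> (\<exists>\<tau>\<in>pauli_group n. A * \<sigma> = \<tau> * A)"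
    if A: "A \<in> carrier (unitary_group (2 ^ n))" and \<sigma>: "\<sigma> \<in> pauli_group n" for \<sigma>
  proof -
    note c = unitary_carrier_mat[OF A] pauli_group_carrier[OF \<sigma>]
    have adj: "mat_adjoint A * A = 1\<^sub>m (2 ^ n)" "A * mat_adjoint A = 1\<^sub>m (2 ^ n)"
      using A unitary_adjoint_right[OF A] by (auto simp: unitary_carrier_iff)
    have "A * \<sigma> = (A * \<sigma> * mat_adjoint A) * A"
      using c adj by (simp add: alg)
    moreover have "A * \<sigma> * mat_adjoint A = \<tau>" if "A * \<sigma> = \<tau> * A" "\<tau> \<in> pauli_group n" for \<tau>
      using c adj pauli_group_carrier[OF that(2)] unfolding that(1) by (simp add: alg)
    ultimately show ?thesis
      by metis
  qed
  then show ?thesis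
    by (auto simp: clifford_unitaries_def unitary_inv)
qed

lemma clifford_unitary: "A \<in> clifford_unitaries n \<Longrightarrow> A \<in> carrier (unitary_group (2 ^ n))"
  by (simp add: clifford_unitaries_iff)

lemma clifford_carrier: "A \<in> clifford_unitaries n \<Longrightarrow> A \<in> carrier_mat (2 ^ n) (2 ^ n)"
  by (simp add: clifford_unitary unitary_carrier_mat)

lemma clifford_conjugate:
  assumes "A \<in> clifford_unitaries n" "\<sigma> \<in> pauli_group n"
  obtains \<tau> where "\<tau> \<in> pauli_group n" "A * \<sigma> = \<tau> * A"
  using assms by (auto simp: clifford_unitaries_iff)

lemma clifford_mult:
  assumes A: "A \<in> clifford_unitaries n" and B: "B \<in> clifford_unitaries n"
  shows "A * B \<in> clifford_unitaries n"
  unfolding clifford_unitaries_iff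
proof (intro conjI ballI)
  show "A * B \<in> carrier (unitary_group (2 ^ n))"
    using A B by (simp add: clifford_unitary unitary_mult)
  fix \<sigma> assume \<sigma>: "\<sigma> \<in> pauli_group n"
  then obtain \<tau> where \<tau>: "\<tau> \<in> pauli_group n" "B * \<sigma> = \<tau> * B"
    using clifford_conjugate[OF B] by blast
  then obtain \<rho> where \<rho>: "\<rho> \<in> pauli_group n" "A * \<tau> = \<rho> * A"
    using clifford_conjugate[OF A] by blast
  note c = clifford_carrier[OF A] clifford_carrier[OF B] pauli_group_carrier[OF \<sigma>]
    pauli_group_carrier[OF \<tau>(1)] pauli_group_carrier[OF \<rho>(1)]
  have "A * B * \<sigma> = \<rho> * (A * B)"
    using intertwine_trans[OF \<tau>(2) \<rho>(2)] c by blast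
  then show "\<exists>\<tau>\<in>pauli_group n. A * B * \<sigma> = \<tau> * (A * B)"
    using \<rho>(1) by blast
qed

text \<open>Conjugation by \<open>A\<close> is an injective map of the Pauli group to itself. As this group is finite, the map is also
  surjective, so that conjugation by the inverse preserves the group, too.\<close>

lemma clifford_adjoint:
  assumes A: "A \<in> clifford_unitaries n"
  shows "mat_adjoint A \<in> clifford_unitaries n"
  unfolding clifford_unitaries_iff
proof (intro conjI ballI)
  note alg = square_mat_algebra[where N = "2 ^ n"]
  have U: "A \<in> carrier (unitary_group (2 ^ n))"
    using A by (rule clifford_unitary)
  then show "mat_adjoint A \<in> carrier (unitary_group (2 ^ n))"
    by (rule unitary_adjoint)
  note cA = clifford_carrier[OF A]
  have adj: "mat_adjoint A * A = 1\<^sub>m (2 ^ n)" "A * mat_adjoint A = 1\<^sub>m (2 ^ n)"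
    using U unitary_adjoint_right[OF U] by (auto simp: unitary_carrier_iff)
  define f where "f \<sigma> = A * \<sigma> * mat_adjoint A" for \<sigma>
  have undo: "mat_adjoint A * f \<sigma> = \<sigma> * mat_adjoint A" if "\<sigma> \<in> pauli_group n" for \<sigma>
  proof -
    have "mat_adjoint A * f \<sigma> = (mat_adjoint A * A) * \<sigma> * mat_adjoint A"
      using cA pauli_group_carrier[OF that] unfolding f_def by (simp add: alg)
    then show ?thesis
      using adj(1) pauli_group_carrier[OF that] by simp
  qed
  have "f ` pauli_group n \<subseteq> pauli_group n"
    using A by (auto simp: f_def clifford_unitaries_def unitary_inv)
  moreover have "inj_on f (pauli_group n)"
    using undo unitary_cancel_right[OF _ unitary_adjoint[OF U]] pauli_group_carrier
    by (metis inj_onI)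
  ultimately have surj: "f ` pauli_group n = pauli_group n"
    by (simp add: endo_inj_surj finite_pauli_group)
  fix \<tau> assume "\<tau> \<in> pauli_group n"
  then obtain \<sigma> where "\<sigma> \<in> pauli_group n" "\<tau> = f \<sigma>"
    using surj by blast
  then show "\<exists>\<sigma>\<in>pauli_group n. mat_adjoint A * \<tau> = \<sigma> * mat_adjoint A"
    using undo by blast
qed

lemma clifford_phase:
  assumes "cmod c = 1"
  shows "c \<cdot>\<^sub>m 1\<^sub>m (2 ^ n) \<in> clifford_unitaries n"
  using assms by (auto simp: clifford_unitaries_iff unitary_smult unitary_one
      square_mat_algebra[where N = "2 ^ n"] pauli_group_carrier intro!: bexI)

lemma clifford_subgroup: "subgroup (clifford_unitaries n) (unitary_group (2 ^ n))"
proof (rule group.subgroupI[OF group_unitary_group])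
  show "clifford_unitaries n \<noteq> {}"
    using clifford_phase[of 1 n] by auto
qed (auto simp: clifford_mult clifford_adjoint clifford_unitary unitary_inv)

section \<open>Quarter turns about Pauli involutions\<close>

text \<open>This is \<open>exp (\<i> \<pi> P / 4)\<close> when \<open>P\<close> is an involution.\<close>

definition quarter_turn :: "complex mat \<Rightarrow> complex mat" where
  "quarter_turn P = of_real (1 / sqrt 2) \<cdot>\<^sub>m (1\<^sub>m (dim_row P) + \<i> \<cdot>\<^sub>m P)"

lemma quarter_turn_eq:
  "P \<in> carrier_mat N N \<Longrightarrow> quarter_turn P = of_real (1 / sqrt 2) \<cdot>\<^sub>m (1\<^sub>m N + \<i> \<cdot>\<^sub>m P)"
  by (auto simp: quarter_turn_def)

lemma quarter_turn_carrier: "P \<in> carrier_mat N N \<Longrightarrow> quarter_turn P \<in> carrier_mat N N"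
  by (auto simp: quarter_turn_def)

lemma quarter_turn_conjugate:
  assumes "A * P = Q * A" "A \<in> carrier_mat N N" "P \<in> carrier_mat N N" "Q \<in> carrier_mat N N"
  shows "A * quarter_turn P = quarter_turn Q * A"
  using assms by (simp add: quarter_turn_eq[where N = N] square_mat_algebra[where N = N])

lemma inverse_sqrt2_square: "of_real (1 / sqrt 2) * of_real (1 / sqrt 2) = (1 / 2 :: complex)"
  by (simp flip: of_real_mult)

lemma quarter_turn_neg_mult:
  assumes "P \<in> carrier_mat N N" "P * P = 1\<^sub>m N"
  shows "quarter_turn ((-1) \<cdot>\<^sub>m P) * quarter_turn P = 1\<^sub>m N"
proof -
  note alg = square_mat_algebra[where N = N]
  define r where "r = complex_of_real (1 / sqrt 2)"
  have rr: "r * r = 1 / 2" "r * (r * x) = x / 2" for x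
    using inverse_sqrt2_square by (simp_all add: r_def flip: mult.assoc)
  have qt: "quarter_turn D = r \<cdot>\<^sub>m (1\<^sub>m N + \<i> \<cdot>\<^sub>m D)" if "D \<in> carrier_mat N N" for D
    using that by (simp add: quarter_turn_eq[where N = N] r_def)
  show ?thesis
    using assms by (simp add: qt alg smult_smult_mat one_smult_mat rr)
      (intro eq_matI, auto simp: algebra_simps rr simp del: index_mult_mat(1))
qed

text \<open>A Pauli operator \<open>\<sigma>\<close> that commutes with \<open>P\<close> is fixed under conjugation by the quarter turn; one that anticommutes
  with \<open>P\<close> is sent to \<open>\<i> P \<sigma>\<close>.\<close>

lemma quarter_turn_clifford:
  assumes P: "P \<in> pauli_involutions n" and "0 < n"
  shows "quarter_turn P \<in> clifford_unitaries n"
  unfolding clifford_unitaries_iff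
proof (intro conjI ballI)
  let ?N = "2 ^ n :: nat"
  note alg = square_mat_algebra[where N = ?N]
  note P' = pauli_involutions_D[OF P]
  have "mat_adjoint P = mat_adjoint P * P * P"
    using P' by (simp add: alg)
  also have "\<dots> = P"
    using P' by (simp add: unitary_carrier_iff)
  finally have adj: "mat_adjoint P = P" .
  have "mat_adjoint (quarter_turn P) = quarter_turn ((-1) \<cdot>\<^sub>m P)"
  proof (rule eq_matI)
    fix i j assume ij: "i < dim_row (quarter_turn ((-1) \<cdot>\<^sub>m P))" "j < dim_col (quarter_turn ((-1) \<cdot>\<^sub>m P))"
    then have "cnj (P $$ (j, i)) = P $$ (i, j)"
      using P'(3) mat_adjoint_index[of i P j] by (simp add: adj quarter_turn_def)
    then show "mat_adjoint (quarter_turn P) $$ (i, j) = quarter_turn ((-1) \<cdot>\<^sub>m P) $$ (i, j)"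
      using ij P'(3) by (auto simp: quarter_turn_def)
  qed (use P' in \<open>auto simp: quarter_turn_def\<close>)
  then show "quarter_turn P \<in> carrier (unitary_group ?N)"
    using P' quarter_turn_neg_mult by (simp add: unitary_carrier_iff quarter_turn_carrier)
  fix \<sigma> assume \<sigma>: "\<sigma> \<in> pauli_group n"
  note c = P'(3) pauli_group_carrier[OF \<sigma>]
  show "\<exists>\<tau>\<in>pauli_group n. quarter_turn P * \<sigma> = \<tau> * quarter_turn P"
    using pauli_group_commute_cases[OF \<sigma> P'(1)]
  proof
    assume "commute_up_to 1 \<sigma> P"
    then show ?thesis
      using \<sigma> c quarter_turn_conjugate[of \<sigma> P P ?N]
      by (intro bexI[of _ \<sigma>]) (simp_all add: commute_up_to_1)
  next
    assume "commute_up_to (-1) \<sigma> P"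
    then have \<sigma>P: "\<sigma> * P = (-1) \<cdot>\<^sub>m (P * \<sigma>)"
      by (simp add: commute_up_to_def)
    have "P * (P * \<sigma>) = P * P * \<sigma>"
      using c by (simp add: alg)
    then have PP: "P * (P * \<sigma>) = \<sigma>"
      using c P'(2) by simp
    have "quarter_turn P * \<sigma> = of_real (1 / sqrt 2) \<cdot>\<^sub>m (\<sigma> + \<i> \<cdot>\<^sub>m (P * \<sigma>))"
      using c by (simp add: quarter_turn_eq[where N = ?N] alg)
    moreover have "(\<i> \<cdot>\<^sub>m (P * \<sigma>)) * quarter_turn P = of_real (1 / sqrt 2) \<cdot>\<^sub>m (\<i> \<cdot>\<^sub>m (P * \<sigma>) + \<sigma>)"
      using c by (simp add: quarter_turn_eq[where N = ?N] alg \<sigma>P PP smult_smult_mat one_smult_mat mult.commute)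
    moreover have "\<i> \<cdot>\<^sub>m (P * \<sigma>) + \<sigma> = \<sigma> + \<i> \<cdot>\<^sub>m (P * \<sigma>)"
      using c by (intro comm_add_mat[of _ ?N ?N]) (simp_all add: alg)
    moreover have "\<i> \<cdot>\<^sub>m (P * \<sigma>) \<in> pauli_group n"
      using \<sigma> P'(1) \<open>0 < n\<close> by (simp add: pauli_group_smult pauli_group_mult pauli_phases_def)
    ultimately show ?thesis
      by metis
  qed
qed

text \<open>The quarter turn about \<open>R\<close> is \<open>(1 + Q P) / \<surd>2\<close>, and \<open>(1 + Q P) P = P + Q = Q (1 + Q P)\<close>.\<close>

lemma quarter_turn_swap:
  assumes P: "P \<in> pauli_involutions n" and Q: "Q \<in> pauli_involutions n" and "0 < n"
    and anti: "commute_up_to (-1) P Q"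
  defines "R \<equiv> (- \<i>) \<cdot>\<^sub>m (Q * P)"
  shows "R \<in> pauli_involutions n" "quarter_turn R * P = Q * quarter_turn R"
    "commute_up_to (-1) P R"
proof -
  let ?N = "2 ^ n :: nat"
  note alg = square_mat_algebra[where N = ?N]
  note P' = pauli_involutions_D[OF P]
  note Q' = pauli_involutions_D[OF Q]
  note c = P'(3) Q'(3)
  have PQ: "P * Q = (-1) \<cdot>\<^sub>m (Q * P)"
    using anti by (simp add: commute_up_to_def)
  have PQP: "P * (Q * P) = (-1) \<cdot>\<^sub>m Q"
  proof -
    have "P * (Q * P) = (P * Q) * P"
      using c by (simp add: alg)
    also have "\<dots> = (-1) \<cdot>\<^sub>m (Q * (P * P))"
      using c unfolding PQ by (simp add: alg)
    finally show ?thesis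
      using c P'(2) by simp
  qed
  have QQP: "Q * (Q * P) = P"
  proof -
    have "Q * (Q * P) = Q * Q * P"
      using c by (simp add: alg)
    then show ?thesis
      using c Q'(2) by simp
  qed
  have "R * R = 1\<^sub>m ?N"
    using c unfolding R_def by (simp add: alg PQP Q'(2) smult_smult_mat one_smult_mat)
  moreover have "R \<in> pauli_group n"
    unfolding R_def using P'(1) Q'(1) \<open>0 < n\<close>
    by (simp add: pauli_group_smult pauli_group_mult pauli_phases_def)
  ultimately show "R \<in> pauli_involutions n"
    by (simp add: pauli_involutions_def)
  have "quarter_turn R = of_real (1 / sqrt 2) \<cdot>\<^sub>m (1\<^sub>m ?N + Q * P)"
    unfolding R_def using c by (simp add: quarter_turn_eq[where N = ?N] alg smult_smult_mat one_smult_mat)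
  then show "quarter_turn R * P = Q * quarter_turn R"
    using c by (simp add: alg P'(2) QQP) (intro eq_matI, auto simp: algebra_simps)
  have "commute_up_to (-1) P (Q * P)"
    using commute_up_to_mult[OF anti, of 1 P ?N] c by (simp add: commute_up_to_1)
  then show "commute_up_to (-1) P R"
    unfolding R_def using c by (intro commute_up_to_smult[where N = ?N]) (simp_all add: alg)
qed

section \<open>Controlled sign flips\<close>

text \<open>For involutions \<open>A\<close> and \<open>B\<close> that are \<open>Z\<close> on two different qubits, this is the controlled-\<open>Z\<close> gate. In general, it acts as
  the identity where \<open>A = 1\<close> and as \<open>B\<close> where \<open>A = - 1\<close>.\<close>

definition controlled_sign :: "complex mat \<Rightarrow> complex mat \<Rightarrow> complex mat" where
  "controlled_sign A B = (1 / 2) \<cdot>\<^sub>m ((1\<^sub>m (dim_row A) + A) + (1\<^sub>m (dim_row A) + (-1) \<cdot>\<^sub>m A) * B)"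

lemma controlled_sign_carrier:
  "A \<in> carrier_mat N N \<Longrightarrow> B \<in> carrier_mat N N \<Longrightarrow> controlled_sign A B \<in> carrier_mat N N"
  by (auto simp: controlled_sign_def)

text \<open>With the complementary projections \<open>p / 2\<close> and \<open>q / 2\<close> onto the eigenspaces of \<open>A\<close>, the claim reads
  \<open>(p + q B) (p + q C) / 4 = (p + q B C) / 2\<close>.\<close>

lemma controlled_sign_mult:
  assumes c: "A \<in> carrier_mat N N" "B \<in> carrier_mat N N" "C \<in> carrier_mat N N"
    and AA: "A * A = 1\<^sub>m N" and AB: "B * A = A * B"
  shows "controlled_sign A B * controlled_sign A C = controlled_sign A (B * C)"
proof -
  note alg = square_mat_algebra[where N = N]
  define p where "p = 1\<^sub>m N + A"
  define q where "q = 1\<^sub>m N + (-1) \<cdot>\<^sub>m A"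
  have pq: "p \<in> carrier_mat N N" "q \<in> carrier_mat N N"
    using c by (auto simp: p_def q_def)
  have "p * p = (1\<^sub>m N + A) + (A + 1\<^sub>m N)" "q * q = (1\<^sub>m N + (-1) \<cdot>\<^sub>m A) + ((-1) \<cdot>\<^sub>m A + 1\<^sub>m N)"
    "p * q = (1\<^sub>m N + A) + ((-1) \<cdot>\<^sub>m A + (-1) \<cdot>\<^sub>m 1\<^sub>m N)" "q * p = (1\<^sub>m N + (-1) \<cdot>\<^sub>m A) + (A + (-1) \<cdot>\<^sub>m 1\<^sub>m N)"
    using c by (simp_all add: p_def q_def alg AA smult_smult_mat one_smult_mat)
  then have idem: "p * p = 2 \<cdot>\<^sub>m p" "q * q = 2 \<cdot>\<^sub>m q" "p * q = 0\<^sub>m N N" "q * p = 0\<^sub>m N N"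
    using c by (auto simp: p_def q_def intro!: eq_matI)
  have Bpq: "B * p = p * B" "B * q = q * B"
    using c AB by (simp_all add: p_def q_def alg)
  have pqC: "p * (q * C) = 0\<^sub>m N N"
  proof -
    have "p * (q * C) = p * q * C"
      using c pq by (simp add: alg)
    then show ?thesis
      using c idem by simp
  qed
  have qBp: "q * (B * p) = 0\<^sub>m N N"
  proof -
    have "q * (B * p) = q * p * B"
      using c pq by (simp add: alg Bpq)
    then show ?thesis
      using c idem by simp
  qed
  have qBqC: "q * (B * (q * C)) = 2 \<cdot>\<^sub>m (q * (B * C))"
  proof -
    have "q * (B * (q * C)) = q * (B * q * C)"
      using c pq by (simp add: alg)
    also have "\<dots> = q * q * (B * C)"
      using c pq unfolding Bpq by (simp add: alg)
    finally show ?thesis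
      using c pq idem by (simp add: alg)
  qed
  have cs: "controlled_sign A D = (1 / 2) \<cdot>\<^sub>m (p + q * D)" for D
    using c by (simp add: controlled_sign_def p_def q_def)
  have "controlled_sign A B * controlled_sign A C =
      (1 / 4) \<cdot>\<^sub>m ((2 \<cdot>\<^sub>m p + 0\<^sub>m N N) + (0\<^sub>m N N + 2 \<cdot>\<^sub>m (q * (B * C))))"
    using c pq by (simp add: cs alg idem pqC qBp qBqC smult_smult_mat)
  also have "\<dots> = controlled_sign A (B * C)"
    using c pq by (simp add: cs alg smult_smult_mat)
  finally show ?thesis .
qed

text \<open>Since \<open>(1 - \<i>A) (1 - \<i>B) (1 + \<i>AB) = (1 - \<i>) (1 + A + B - AB)\<close> for commuting involutions.\<close>

lemma quarter_turn_controlled_sign: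
  assumes c: "A \<in> carrier_mat N N" "B \<in> carrier_mat N N"
    and AA: "A * A = 1\<^sub>m N" and BB: "B * B = 1\<^sub>m N" and BA: "B * A = A * B"
  shows "quarter_turn ((-1) \<cdot>\<^sub>m A) * quarter_turn ((-1) \<cdot>\<^sub>m B) * quarter_turn (A * B) =
    of_real (1 / sqrt 2) * (1 - \<i>) \<cdot>\<^sub>m controlled_sign A B"
proof -
  note alg = square_mat_algebra[where N = N]
  define r where "r = complex_of_real (1 / sqrt 2)"
  have rr: "r * r = 1 / 2" "r * (r * x) = x / 2" for x
    using inverse_sqrt2_square by (simp_all add: r_def flip: mult.assoc)
  have AAB: "A * (A * B) = B"
  proof -
    have "A * (A * B) = A * A * B"
      using c by (simp add: alg)
    then show ?thesis
      using c AA by simp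
  qed
  have BAB: "B * (A * B) = A"
  proof -
    have "B * (A * B) = B * (B * A)"
      by (simp add: BA)
    also have "\<dots> = B * B * A"
      using c by (simp add: alg)
    finally show ?thesis
      using c BB by simp
  qed
  have ABAB: "A * (B * (A * B)) = 1\<^sub>m N"
    by (simp add: BAB AA)
  have qt: "quarter_turn D = r \<cdot>\<^sub>m (1\<^sub>m N + \<i> \<cdot>\<^sub>m D)" if "D \<in> carrier_mat N N" for D
    using that by (simp add: quarter_turn_eq[where N = N] r_def)
  let ?M = "(1\<^sub>m N + (- \<i>) \<cdot>\<^sub>m B) + ((- \<i>) \<cdot>\<^sub>m A + (-1) \<cdot>\<^sub>m (A * B))"
  have "quarter_turn ((-1) \<cdot>\<^sub>m A) * quarter_turn ((-1) \<cdot>\<^sub>m B) = (1 / 2) \<cdot>\<^sub>m ?M"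
    using c by (simp add: qt alg smult_smult_mat rr)
      (intro eq_matI, auto simp: algebra_simps rr simp del: index_mult_mat(1))
  moreover have "?M * (1\<^sub>m N + \<i> \<cdot>\<^sub>m (A * B)) = ?M +
      ((\<i> \<cdot>\<^sub>m (A * B) + A) + (B + (- \<i>) \<cdot>\<^sub>m 1\<^sub>m N))"
    using c by (simp add: alg smult_smult_mat AAB BAB ABAB AA one_smult_mat)
  moreover have "((1 / 2) \<cdot>\<^sub>m D) * (r \<cdot>\<^sub>m E) = (r / 2) \<cdot>\<^sub>m (D * E)"
    if "D \<in> carrier_mat N N" "E \<in> carrier_mat N N" for D E
    using that by (simp add: alg smult_smult_mat)
  moreover have "?M \<in> carrier_mat N N" "1\<^sub>m N + \<i> \<cdot>\<^sub>m (A * B) \<in> carrier_mat N N" "A * B \<in> carrier_mat N N"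
    using c by (simp_all add: alg)
  ultimately have "quarter_turn ((-1) \<cdot>\<^sub>m A) * quarter_turn ((-1) \<cdot>\<^sub>m B) * quarter_turn (A * B) =
      (r / 2) \<cdot>\<^sub>m (?M + ((\<i> \<cdot>\<^sub>m (A * B) + A) + (B + (- \<i>) \<cdot>\<^sub>m 1\<^sub>m N)))"
    by (simp only: qt)
  also have "\<dots> = (r * (1 - \<i>)) \<cdot>\<^sub>m ((1 / 2) \<cdot>\<^sub>m ((1\<^sub>m N + A) + (B + (-1) \<cdot>\<^sub>m (A * B))))"
    using c by (intro eq_matI) (auto simp: field_simps simp del: index_mult_mat(1))
  also have "(1 / 2) \<cdot>\<^sub>m ((1\<^sub>m N + A) + (B + (-1) \<cdot>\<^sub>m (A * B))) = controlled_sign A B"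
    using c by (simp add: controlled_sign_def alg)
  finally show ?thesis
    by (simp add: r_def)
qed

section \<open>Single-site operators under Clifford conjugation\<close>

lemma XZ_pauli: "\<sigma> \<in> {pauli_X, pauli_Z} \<Longrightarrow> \<sigma> \<in> pauli_matrices"
  by (auto simp: pauli_matrices_def)

lemma site_involution: "\<sigma> \<in> pauli_matrices \<Longrightarrow> site n j \<sigma> \<in> pauli_involutions n"
  by (simp add: site_mem_pauli_strings pauli_strings_subset_involutions)

lemma site_X_anticommutes_Z:
  assumes "j < n"
  shows "commute_up_to (-1) (site n j pauli_X) (site n j pauli_Z)"
proof -
  have "pauli_X * pauli_Z = (-1) \<cdot>\<^sub>m (pauli_Z * pauli_X)"
    by (simp add: mat2_simps)
  then show ?thesis
    using assms by (simp add: commute_up_to_def site_mult site_smult pauli_carrier XZ_pauli)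
qed

lemma sites_commute:
  "i \<noteq> j \<Longrightarrow> \<sigma> \<in> pauli_matrices \<Longrightarrow> \<tau> \<in> pauli_matrices \<Longrightarrow> commute_up_to 1 (site n i \<sigma>) (site n j \<tau>)"
  by (simp add: commute_up_to_1 site_commute pauli_carrier)

lemma scalar_if_commutes_with_sites:
  assumes A: "A \<in> carrier (unitary_group (2 ^ n))"
    and comm: "\<And>j \<sigma>. j < n \<Longrightarrow> \<sigma> \<in> {pauli_X, pauli_Z} \<Longrightarrow> commute_up_to 1 A (site n j \<sigma>)"
  obtains c where "A = c \<cdot>\<^sub>m 1\<^sub>m (2 ^ n)" "cmod c = 1"
proof -
  let ?N = "2 ^ n :: nat"
  obtain c where c: "A = c \<cdot>\<^sub>m 1\<^sub>m ?N"
    using commutant_of_sites[OF unitary_carrier_mat[OF A]] comm by (auto simp: commute_up_to_1)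
  then have "cmod c = 1"
    using A cmod_unitary_scalar[of c ?N] by simp
  then show ?thesis
    using that c by blast
qed

text \<open>\<open>P\<close> squares to \<open>1\<close> because it is a conjugate of \<open>X\<close>.\<close>

lemma conjugate_involution:
  assumes A: "A \<in> clifford_unitaries n" and X: "X \<in> pauli_involutions n"
  obtains P where "P \<in> pauli_involutions n" "A * X = P * A"
proof -
  let ?N = "2 ^ n :: nat"
  obtain P where P: "P \<in> pauli_group n" "A * X = P * A"
    using clifford_conjugate[OF A pauli_involutions_D(1)[OF X]] .
  note c = clifford_carrier[OF A] pauli_group_carrier[OF P(1)] pauli_involutions_D(3)[OF X]
  have "P * P * A = P * (A * X)"
    unfolding P(2) using c by (simp add: square_mat_algebra[where N = ?N])
  also have "\<dots> = P * A * X"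
    using c by (simp add: square_mat_algebra[where N = ?N])
  also have "\<dots> = A * (X * X)"
    unfolding P(2)[symmetric] using c by (simp add: square_mat_algebra[where N = ?N])
  also have "\<dots> = 1\<^sub>m ?N * A"
    using c pauli_involutions_D(2)[OF X] by simp
  finally have "P * P = 1\<^sub>m ?N"
    by (rule unitary_cancel_right[OF _ clifford_unitary[OF A]])
      (use c in \<open>simp_all add: square_mat_algebra[where N = ?N]\<close>)
  then show ?thesis
    using that P by (simp add: pauli_involutions_def)
qed

text \<open>Conjugation by \<open>A\<close> fixes the Pauli operators of the first \<open>k\<close> qubits exactly, not only
  up to sign.\<close>

definition fixes_sites_below :: "nat \<Rightarrow> nat \<Rightarrow> complex mat \<Rightarrow> bool" where
  "fixes_sites_below n k A \<longleftrightarrow> (\<forall>j<k. \<forall>\<sigma>\<in>{pauli_X, pauli_Z}. commute_up_to 1 A (site n j \<sigma>))"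

lemma conjugate_keeps_commutation:
  assumes A: "A \<in> clifford_unitaries n" "commute_up_to 1 A F" "F \<in> carrier_mat (2 ^ n) (2 ^ n)"
    and P: "P \<in> pauli_involutions n" "A * X = P * A" and X: "X \<in> pauli_involutions n" "commute_up_to s F X"
  shows "commute_up_to s F P"
  by (rule commute_up_to_conjugate[OF X(2) _ P(2) clifford_unitary[OF A(1)]])
    (use A P X in \<open>auto simp: commute_up_to_1 pauli_involutions_D\<close>)

lemma conjugate_commutes_with_lower_sites:
  assumes A: "A \<in> clifford_unitaries n" "fixes_sites_below n k A"
    and P: "P \<in> pauli_involutions n" "A * S = P * A" and S: "S = site n k \<sigma>" "\<sigma> \<in> pauli_matrices"
    and F: "F = site n j \<tau>" "j < k" "\<tau> \<in> {pauli_X, pauli_Z}"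
  shows "commute_up_to 1 F P"
  by (rule conjugate_keeps_commutation[OF A(1) _ _ P])
    (use A F S in \<open>auto simp: fixes_sites_below_def site_carrier pauli_carrier XZ_pauli site_involution
      intro!: sites_commute\<close>)

section \<open>Homomorphisms to commutative groups\<close>

text \<open>A homomorphism from the Clifford group to a commutative group, given on representatives. Commutativity of the target
  makes \<open>\<phi>\<close> constant on conjugacy classes, which turns conjugacy of quarter turns into equations between values of \<open>\<phi>\<close>.\<close>

locale phase_killing_hom =
  fixes n :: nat and K :: "('k, 'm) monoid_scheme" and \<phi> :: "complex mat \<Rightarrow> 'k"
  assumes comm_group_K: "comm_group K" and three_le: "3 \<le> n"
    and phi_closed: "A \<in> clifford_unitaries n \<Longrightarrow> \<phi> A \<in> carrier K"
    and phi_mult: "A \<in> clifford_unitaries n \<Longrightarrow> B \<in> clifford_unitaries n \<Longrightarrow> \<phi> (A * B) = \<phi> A \<otimes>\<^bsub>K\<^esub> \<phi> B"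
    and phi_phase: "cmod c = 1 \<Longrightarrow> \<phi> (c \<cdot>\<^sub>m 1\<^sub>m (2 ^ n)) = \<one>\<^bsub>K\<^esub>"
begin

interpretation K: comm_group K
  by (rule comm_group_K)

lemma n_pos: "0 < n"
  using three_le by simp

lemma phi_conjugate:
  assumes A: "A \<in> clifford_unitaries n" and P: "P \<in> pauli_involutions n" and Q: "Q \<in> pauli_involutions n"
    and eq: "A * P = Q * A"
  shows "\<phi> (quarter_turn P) = \<phi> (quarter_turn Q)"
proof -
  note qt = quarter_turn_clifford[OF P n_pos] quarter_turn_clifford[OF Q n_pos]
  have "A * quarter_turn P = quarter_turn Q * A"
    using A P Q eq
    by (intro quarter_turn_conjugate[where N = "2 ^ n"]) (auto simp: clifford_carrier pauli_involutions_D)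
  then have "\<phi> A \<otimes>\<^bsub>K\<^esub> \<phi> (quarter_turn P) = \<phi> A \<otimes>\<^bsub>K\<^esub> \<phi> (quarter_turn Q)"
    using phi_mult[OF A qt(1)] phi_mult[OF qt(2) A] phi_closed[OF A] phi_closed[OF qt(2)]
    by (simp add: K.m_comm)
  then show ?thesis
    using phi_closed[OF A] phi_closed[OF qt(1)] phi_closed[OF qt(2)] by simp
qed

lemma phi_anticommuting:
  assumes P: "P \<in> pauli_involutions n" and Q: "Q \<in> pauli_involutions n" and anti: "commute_up_to (-1) P Q"
  shows "\<phi> (quarter_turn P) = \<phi> (quarter_turn Q)"
  using quarter_turn_swap[OF P Q n_pos anti] quarter_turn_clifford n_pos phi_conjugate[OF _ P Q] by blast

text \<open>The hypotheses on \<open>R1\<close> and \<open>R2\<close> say that \<open>P\<close> and \<open>Q\<close> are noncentral in the Pauli group.\<close>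

lemma phi_quarter_turn_eq:
  assumes P: "P \<in> pauli_involutions n" and Q: "Q \<in> pauli_involutions n"
    and R1: "R1 \<in> pauli_group n" "commute_up_to (-1) P R1"
    and R2: "R2 \<in> pauli_group n" "commute_up_to (-1) Q R2"
  shows "\<phi> (quarter_turn P) = \<phi> (quarter_turn Q)"
proof -
  obtain R where "R \<in> pauli_involutions n" "commute_up_to (-1) P R" "commute_up_to (-1) Q R"
    using common_anticommuter[OF pauli_involutions_D(1)[OF P] pauli_involutions_D(1)[OF Q] n_pos R1 R2] .
  then show ?thesis
    using phi_anticommuting[OF P] phi_anticommuting[OF Q] by metis
qed

text \<open>The identity \<open>CZ(A, B) CZ(A, C) = CZ(A, BC)\<close>, written in quarter turns, yields \<open>t\<^sup>6 = t\<^sup>3\<close>. Each \<open>CZ\<close> is, up to a phase, a product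
  of an odd number of quarter turns, which makes this relation independent of \<open>t\<^sup>2 = 1\<close>.\<close>

lemma phi_controlled_sign_relation:
  assumes carrier: "A \<in> pauli_involutions n" "B \<in> pauli_involutions n" "C \<in> pauli_involutions n"
      "A * B \<in> pauli_involutions n" "A * C \<in> pauli_involutions n" "B * C \<in> pauli_involutions n"
      "A * (B * C) \<in> pauli_involutions n"
    and comm: "B * A = A * B" "C * A = A * C"
    and t: "\<And>P. P \<in> {(-1) \<cdot>\<^sub>m A, (-1) \<cdot>\<^sub>m B, (-1) \<cdot>\<^sub>m C, (-1) \<cdot>\<^sub>m (B * C), A * B, A * C, A * (B * C)} \<Longrightarrow>
      \<phi> (quarter_turn P) = t"
  shows "t \<otimes>\<^bsub>K\<^esub> t \<otimes>\<^bsub>K\<^esub> t = \<one>\<^bsub>K\<^esub>"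
proof -
  let ?N = "2 ^ n :: nat"
  note alg = square_mat_algebra[where N = ?N]
  define c where "c = complex_of_real (1 / sqrt 2) * (1 - \<i>)"
  have "cmod (1 - \<i>) = sqrt 2"
    by (simp add: cmod_def)
  then have norm_c: "cmod c = 1"
    by (simp add: c_def norm_mult norm_divide)
  have cA: "A \<in> carrier_mat ?N ?N" "B \<in> carrier_mat ?N ?N" "C \<in> carrier_mat ?N ?N"
    using carrier by (auto simp: pauli_involutions_D)
  define T where "T D E = quarter_turn ((-1) \<cdot>\<^sub>m D) * quarter_turn ((-1) \<cdot>\<^sub>m E) * quarter_turn (D * E)" for D E
  have T: "T A D = c \<cdot>\<^sub>m controlled_sign A D"
    if "D \<in> pauli_involutions n" "D * A = A * D" for D
    unfolding T_def c_def using that carrier(1)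
    by (intro quarter_turn_controlled_sign) (auto simp: pauli_involutions_D)
  have T_clifford: "T D E \<in> clifford_unitaries n"
    if "D \<in> pauli_involutions n" "E \<in> pauli_involutions n" "D * E \<in> pauli_involutions n" for D E
    unfolding T_def using that n_pos
    by (intro clifford_mult quarter_turn_clifford pauli_involution_smult) auto
  have BCA: "B * C * A = A * (B * C)"
    using commute_up_to_mult[of 1 A B 1 C ?N] cA comm by (simp add: commute_up_to_1)
  have "T A B * T A C = (c * c) \<cdot>\<^sub>m (controlled_sign A B * controlled_sign A C)"
    using cA carrier comm by (simp add: T alg controlled_sign_carrier smult_smult_mat mult.commute)
  also have "\<dots> = (c * c) \<cdot>\<^sub>m controlled_sign A (B * C)"
    using cA carrier comm by (simp add: controlled_sign_mult[where N = ?N] pauli_involutions_D(2))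
  also have "\<dots> = (c \<cdot>\<^sub>m 1\<^sub>m ?N) * T A (B * C)"
    using cA carrier BCA by (simp add: T alg controlled_sign_carrier smult_smult_mat)
  finally have rel: "T A B * T A C = (c \<cdot>\<^sub>m 1\<^sub>m ?N) * T A (B * C)" .
  have t_closed: "t \<in> carrier K"
    using t[of "A * B"] phi_closed[OF quarter_turn_clifford[OF carrier(4) n_pos]] by simp
  have phi_T: "\<phi> (T D E) = t \<otimes>\<^bsub>K\<^esub> t \<otimes>\<^bsub>K\<^esub> t"
    if "D \<in> pauli_involutions n" "E \<in> pauli_involutions n" "D * E \<in> pauli_involutions n"
      "\<phi> (quarter_turn ((-1) \<cdot>\<^sub>m D)) = t" "\<phi> (quarter_turn ((-1) \<cdot>\<^sub>m E)) = t" "\<phi> (quarter_turn (D * E)) = t" for D E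
    using that n_pos by (simp add: T_def phi_mult clifford_mult quarter_turn_clifford pauli_involution_smult)
  have phi_TA: "\<phi> (T A B) = t \<otimes>\<^bsub>K\<^esub> t \<otimes>\<^bsub>K\<^esub> t" "\<phi> (T A C) = t \<otimes>\<^bsub>K\<^esub> t \<otimes>\<^bsub>K\<^esub> t"
    "\<phi> (T A (B * C)) = t \<otimes>\<^bsub>K\<^esub> t \<otimes>\<^bsub>K\<^esub> t"
    using carrier t by (auto intro!: phi_T)
  have "\<phi> (T A B) \<otimes>\<^bsub>K\<^esub> \<phi> (T A C) = \<one>\<^bsub>K\<^esub> \<otimes>\<^bsub>K\<^esub> \<phi> (T A (B * C))"
    using arg_cong[OF rel, of \<phi>] carrier norm_c
    by (simp add: phi_mult T_clifford clifford_phase phi_phase)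
  then show ?thesis
    using t_closed by (simp add: phi_TA)
qed

text \<open>This is where three qubits are needed: the operators \<open>Z\<close> on qubits 0, 1, 2 and their products are
  all noncentral, as each anticommutes with some \<open>X\<close>.\<close>

lemma phi_quarter_turn_noncentral:
  assumes P: "P \<in> pauli_involutions n" and R: "R \<in> pauli_group n" "commute_up_to (-1) P R"
  shows "\<phi> (quarter_turn P) = \<one>\<^bsub>K\<^esub>"
proof -
  let ?N = "2 ^ n :: nat"
  define t where "t = \<phi> (quarter_turn P)"
  have t_closed: "t \<in> carrier K"
    unfolding t_def by (intro phi_closed quarter_turn_clifford P n_pos)
  have all_t: "\<phi> (quarter_turn Q) = t"
    if "Q \<in> pauli_involutions n" "S \<in> pauli_group n" "commute_up_to (-1) S Q" for Q S
    unfolding t_def using phi_quarter_turn_eq[OF that(1) P that(2) _ R] commute_up_to_sym[OF that(3)] by simp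
  have neg: "commute_up_to (-1) S ((-1) \<cdot>\<^sub>m Q)" if "Q \<in> pauli_involutions n" "S \<in> pauli_group n"
    "commute_up_to (-1) S Q" for Q S
    using that by (intro commute_up_to_smult[where N = ?N]) (auto simp: pauli_involutions_D pauli_group_carrier)
  have neg_t: "\<phi> (quarter_turn ((-1) \<cdot>\<^sub>m Q)) = t"
    if "Q \<in> pauli_involutions n" "S \<in> pauli_group n" "commute_up_to (-1) S Q" for Q S
    using all_t[OF pauli_involution_smult[OF that(1) n_pos] that(2) neg[OF that]] .
  \<comment> \<open>\<open>- P\<close> is as noncentral as \<open>P\<close>, so its quarter turn, the inverse of that of \<open>P\<close>, has the same value.\<close>
  have "\<phi> (quarter_turn ((-1) \<cdot>\<^sub>m P) * quarter_turn P) = \<one>\<^bsub>K\<^esub>"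
    using quarter_turn_neg_mult[OF pauli_involutions_D(3,2)[OF P]] phi_phase[of 1] by (simp add: one_smult_mat)
  then have t2: "t \<otimes>\<^bsub>K\<^esub> t = \<one>\<^bsub>K\<^esub>"
    using neg_t[OF P R(1) commute_up_to_sym[OF R(2)]] P n_pos
    by (simp add: phi_mult quarter_turn_clifford pauli_involution_smult flip: t_def)
  define Z where "Z j = site n j pauli_Z" for j
  define X where "X j = site n j pauli_X" for j
  have Z: "Z j \<in> pauli_involutions n" and X: "X j \<in> pauli_group n" for j
    by (simp_all add: Z_def X_def site_involution site_mem_pauli_group XZ_pauli)
  have cZ: "Z j \<in> carrier_mat ?N ?N" and cX: "X j \<in> carrier_mat ?N ?N" for j
    using Z X by (auto simp: pauli_involutions_D pauli_group_carrier)
  have ZZ: "Z i * Z j = Z j * Z i" for i j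
    unfolding Z_def by (cases "i = j") (simp_all add: site_commute pauli_carrier XZ_pauli)
  have XZ_eq: "commute_up_to (-1) (X j) (Z j)" if "j < n" for j
    unfolding Z_def X_def using that by (rule site_X_anticommutes_Z)
  have XZ_neq: "commute_up_to 1 (X i) (Z j)" if "i \<noteq> j" for i j
    unfolding Z_def X_def using that by (simp add: sites_commute XZ_pauli)
  have prod_involution: "D * E \<in> pauli_involutions n"
    if "D \<in> pauli_involutions n" "E \<in> pauli_involutions n" "E * D = D * E" for D E
  proof -
    note c = pauli_involutions_D(3)[OF that(1)] pauli_involutions_D(3)[OF that(2)]
    have "D * E * (D * E) = D * (E * D) * E"
      using c by (simp add: square_mat_algebra[where N = ?N])
    also have "\<dots> = D * D * (E * E)"
      using c unfolding that(3) by (simp add: square_mat_algebra[where N = ?N])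
    finally show ?thesis
      using that(1,2) by (simp add: pauli_involutions_def pauli_group_mult)
  qed
  have Z012: "Z 1 * Z 2 * Z 0 = Z 0 * (Z 1 * Z 2)"
    using commute_up_to_mult[of 1 "Z 0" "Z 1" 1 "Z 2" ?N] cZ ZZ by (simp add: commute_up_to_1)
  note inv = Z prod_involution[OF Z Z ZZ] prod_involution[OF Z prod_involution[OF Z Z ZZ] Z012]
  have X0: "commute_up_to (-1) (X 0) (Z 0)" "commute_up_to (-1) (X 0) (Z 0 * Z 1)"
    "commute_up_to (-1) (X 0) (Z 0 * Z 2)" "commute_up_to (-1) (X 0) (Z 0 * (Z 1 * Z 2))"
    and X1: "commute_up_to (-1) (X 1) (Z 1)" "commute_up_to (-1) (X 1) (Z 1 * Z 2)"
    and X2: "commute_up_to (-1) (X 2) (Z 2)"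
  proof -
    have mult: "commute_up_to (-1) (X i) (Z i * D)"
      if "i < n" "commute_up_to 1 (X i) D" "D \<in> carrier_mat ?N ?N" for i D
      using commute_up_to_mult[OF XZ_eq[OF that(1)] that(2) cX cZ that(3)] by simp
    have "commute_up_to 1 (X 0) (Z 1 * Z 2)"
      using commute_up_to_mult[OF XZ_neq XZ_neq cX cZ cZ, of 0 1 2] by simp
    then show "commute_up_to (-1) (X 0) (Z 0 * (Z 1 * Z 2))"
      using three_le cZ by (intro mult) (auto intro!: mult_carrier_mat)
    show "commute_up_to (-1) (X 0) (Z 0 * Z 1)" "commute_up_to (-1) (X 0) (Z 0 * Z 2)"
      "commute_up_to (-1) (X 1) (Z 1 * Z 2)"
      using three_le by (auto intro!: mult XZ_neq cZ simp del: One_nat_def)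
  qed (use three_le XZ_eq in auto)
  have "t \<otimes>\<^bsub>K\<^esub> t \<otimes>\<^bsub>K\<^esub> t = \<one>\<^bsub>K\<^esub>"
  proof (rule phi_controlled_sign_relation[of "Z 0" "Z 1" "Z 2"])
    fix Q assume "Q \<in> {(-1) \<cdot>\<^sub>m Z 0, (-1) \<cdot>\<^sub>m Z 1, (-1) \<cdot>\<^sub>m Z 2, (-1) \<cdot>\<^sub>m (Z 1 * Z 2), Z 0 * Z 1, Z 0 * Z 2,
        Z 0 * (Z 1 * Z 2)}"
    then show "\<phi> (quarter_turn Q) = t"
      using neg_t[OF Z X X0(1)] neg_t[OF Z X X1(1)] neg_t[OF Z X X2] neg_t[OF inv(2) X X1(2)]
        all_t[OF inv(2) X X0(2)] all_t[OF inv(2) X X0(3)] all_t[OF inv(3) X X0(4)] by blast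
  qed (use inv ZZ in auto)
  then show ?thesis
    using t2 t_closed by (simp add: t_def)
qed

lemma phi_scalar:
  assumes A: "A \<in> carrier (unitary_group (2 ^ n))"
    and comm: "\<And>j \<sigma>. j < n \<Longrightarrow> \<sigma> \<in> {pauli_X, pauli_Z} \<Longrightarrow> commute_up_to 1 A (site n j \<sigma>)"
  shows "\<phi> A = \<one>\<^bsub>K\<^esub>"
  using scalar_if_commutes_with_sites[OF A comm] phi_phase by metis

text \<open>The quarter turn about \<open>- \<i>QP\<close> commutes with every operator that commutes with both or anticommutes with both
  of \<open>P\<close> and \<open>Q\<close>, as such an operator commutes with \<open>QP\<close>.\<close>

lemma move_anticommuting:
  assumes P: "P \<in> pauli_involutions n" and Q: "Q \<in> pauli_involutions n" and anti: "commute_up_to (-1) P Q"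
  obtains E where "E \<in> clifford_unitaries n" "\<phi> E = \<one>\<^bsub>K\<^esub>" "E * P = Q * E"
    "\<And>F s. \<lbrakk>F \<in> carrier_mat (2 ^ n) (2 ^ n); s \<in> {1, - 1}; commute_up_to s F P; commute_up_to s F Q\<rbrakk>
      \<Longrightarrow> E * F = F * E"
proof -
  let ?N = "2 ^ n :: nat"
  define R where "R = (- \<i>) \<cdot>\<^sub>m (Q * P)"
  note swap = quarter_turn_swap[OF P Q n_pos anti, folded R_def]
  note c = pauli_involutions_D(3)[OF P] pauli_involutions_D(3)[OF Q] pauli_involutions_D(3)[OF swap(1)]
  show ?thesis
  proof (rule that)
    show "quarter_turn R \<in> clifford_unitaries n"
      using swap(1) n_pos by (rule quarter_turn_clifford)
    show "\<phi> (quarter_turn R) = \<one>\<^bsub>K\<^esub>"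
      using phi_quarter_turn_noncentral[OF swap(1) pauli_involutions_D(1)[OF P] commute_up_to_sym[OF swap(3)]]
      by simp
    show "quarter_turn R * P = Q * quarter_turn R"
      by (rule swap(2))
    fix F s assume F: "F \<in> carrier_mat ?N ?N" "s \<in> {1, - 1 :: complex}" "commute_up_to s F P" "commute_up_to s F Q"
    then have "commute_up_to 1 F (Q * P)"
      using commute_up_to_mult[OF F(4,3,1) c(2,1)] by auto
    then have "commute_up_to 1 F R"
      unfolding R_def using F c by (intro commute_up_to_smult[where N = ?N]) (auto simp: square_mat_algebra)
    then show "quarter_turn R * F = F * quarter_turn R"
      using F c by (simp add: commute_up_to_1 quarter_turn_conjugate[where N = ?N])
  qed
qed

text \<open>Even commuting \<open>P\<close> and \<open>Q\<close> are moved to one another, in two steps through an involution \<open>R\<close> that anticommutes with both.\<close>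

lemma move_via:
  assumes P: "P \<in> pauli_involutions n" and Q: "Q \<in> pauli_involutions n" and R: "R \<in> pauli_involutions n"
    and anti: "commute_up_to (-1) P R" "commute_up_to (-1) Q R"
  obtains E where "E \<in> clifford_unitaries n" "\<phi> E = \<one>\<^bsub>K\<^esub>" "E * P = Q * E"
    "\<And>F s. \<lbrakk>F \<in> carrier_mat (2 ^ n) (2 ^ n); s \<in> {1, - 1}; commute_up_to s F P; commute_up_to s F Q;
      commute_up_to s F R\<rbrakk> \<Longrightarrow> E * F = F * E"
proof -
  let ?N = "2 ^ n :: nat"
  obtain D where D: "D \<in> clifford_unitaries n" "\<phi> D = \<one>\<^bsub>K\<^esub>" "D * P = R * D"
    "\<And>F s. \<lbrakk>F \<in> carrier_mat ?N ?N; s \<in> {1, - 1}; commute_up_to s F P; commute_up_to s F R\<rbrakk> \<Longrightarrow> D * F = F * D"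
    using move_anticommuting[OF P R anti(1)] by metis
  have "commute_up_to (-1) R Q"
    using anti(2) by (rule commute_up_to_sym) simp
  then obtain E where E: "E \<in> clifford_unitaries n" "\<phi> E = \<one>\<^bsub>K\<^esub>" "E * R = Q * E"
    "\<And>F s. \<lbrakk>F \<in> carrier_mat ?N ?N; s \<in> {1, - 1}; commute_up_to s F R; commute_up_to s F Q\<rbrakk> \<Longrightarrow> E * F = F * E"
    using move_anticommuting[OF R Q] by metis
  note c = clifford_carrier[OF D(1)] clifford_carrier[OF E(1)] pauli_involutions_D(3)[OF P]
    pauli_involutions_D(3)[OF Q] pauli_involutions_D(3)[OF R]
  show ?thesis
  proof (rule that)
    show "E * D \<in> clifford_unitaries n"
      using E(1) D(1) by (rule clifford_mult)
    show "\<phi> (E * D) = \<one>\<^bsub>K\<^esub>"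
      by (simp add: phi_mult D E)
    show "E * D * P = Q * (E * D)"
      using intertwine_trans[OF D(3) E(3)] c by blast
    show "E * D * F = F * (E * D)"
      if "F \<in> carrier_mat ?N ?N" "s \<in> {1, - 1}" "commute_up_to s F P" "commute_up_to s F Q" "commute_up_to s F R" for F s
      using intertwine_trans[OF D(4)[OF that(1,2,3,5)] E(4)[OF that(1,2,5,4)]] that(1) c by blast
  qed
qed

text \<open>One step of the reduction: \<open>E\<close> undoes the effect of \<open>A\<close> on \<open>X\<close>.\<close>

lemma correct_conjugate:
  assumes A: "A \<in> clifford_unitaries n" and P: "P \<in> pauli_involutions n" "A * X = P * A"
    and X: "X \<in> pauli_involutions n"
    and E: "E \<in> clifford_unitaries n" "\<phi> E = \<one>\<^bsub>K\<^esub>" "E * P = X * E"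
  shows "E * A \<in> clifford_unitaries n" "\<phi> (E * A) = \<phi> A" "commute_up_to 1 (E * A) X"
    "\<And>F. \<lbrakk>F \<in> carrier_mat (2 ^ n) (2 ^ n); commute_up_to 1 A F; E * F = F * E\<rbrakk> \<Longrightarrow> commute_up_to 1 (E * A) F"
proof -
  let ?N = "2 ^ n :: nat"
  note c = clifford_carrier[OF A] clifford_carrier[OF E(1)] pauli_involutions_D(3)[OF P(1)] pauli_involutions_D(3)[OF X]
  show "E * A \<in> clifford_unitaries n"
    using E(1) A by (rule clifford_mult)
  show "\<phi> (E * A) = \<phi> A"
    using A E phi_closed by (simp add: phi_mult)
  show "commute_up_to 1 (E * A) X"
    using intertwine_trans[OF P(2) E(3)] c by (simp add: commute_up_to_1)
  show "commute_up_to 1 (E * A) F" if "F \<in> carrier_mat ?N ?N" "commute_up_to 1 A F" "E * F = F * E" for F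
    using intertwine_trans[OF that(2)[unfolded commute_up_to_1] that(3)] that(1) c by (simp add: commute_up_to_1)
qed

text \<open>The conjugate \<open>P\<close> of \<open>X\<^sub>k\<close> commutes with all operators on the qubits below \<open>k\<close>, and it is no scalar. So it anticommutes with some
  \<open>X\<^sub>j\<close> or \<open>Z\<^sub>j\<close> with \<open>j \<ge> k\<close>, while \<open>X\<^sub>k\<close> anticommutes with \<open>Z\<^sub>k\<close>. These two provide a common
  anticommuting involution that commutes with everything on the lower qubits.\<close>

lemma reduce_X:
  assumes A: "A \<in> clifford_unitaries n" "fixes_sites_below n k A" and k: "k < n"
  obtains B where "B \<in> clifford_unitaries n" "\<phi> B = \<phi> A" "fixes_sites_below n k B"
    "commute_up_to 1 B (site n k pauli_X)"
proof -
  let ?N = "2 ^ n :: nat"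
  define X where "X = site n k pauli_X"
  define Z where "Z = site n k pauli_Z"
  have X: "X \<in> pauli_involutions n" and Z: "Z \<in> pauli_involutions n"
    by (simp_all add: X_def Z_def site_involution XZ_pauli)
  have XZ: "commute_up_to (-1) X Z"
    unfolding X_def Z_def using k by (rule site_X_anticommutes_Z)
  obtain P where P: "P \<in> pauli_involutions n" "A * X = P * A"
    using conjugate_involution[OF A(1) X] .
  have low: "commute_up_to 1 F P" "commute_up_to 1 F X" "commute_up_to 1 F Z" "commute_up_to 1 A F" "F \<in> carrier_mat ?N ?N"
    if "F = site n j \<sigma>" "j < k" "\<sigma> \<in> {pauli_X, pauli_Z}" for F j \<sigma>
  proof -
    show F: "F \<in> carrier_mat ?N ?N" "commute_up_to 1 A F"
      using that A(2) by (auto simp: fixes_sites_below_def site_carrier pauli_carrier XZ_pauli)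
    show "commute_up_to 1 F X" "commute_up_to 1 F Z"
      using that by (auto simp: X_def Z_def sites_commute XZ_pauli)
    show "commute_up_to 1 F P"
      using conjugate_commutes_with_lower_sites[OF A P X_def _ that] by (simp add: XZ_pauli)
  qed
  \<comment> \<open>\<open>P\<close> anticommutes with the conjugate of \<open>Z\<^sub>k\<close>, hence it is not a scalar.\<close>
  obtain Z' where Z': "Z' \<in> pauli_involutions n" "A * Z = Z' * A"
    using conjugate_involution[OF A(1) Z] .
  have PZ': "commute_up_to (-1) P Z'"
    using commute_up_to_conjugate[OF XZ P(2) Z'(2) clifford_unitary[OF A(1)]] X Z P Z'
    by (simp add: pauli_involutions_D)
  have "\<exists>j<n. \<exists>\<sigma>\<in>{pauli_X, pauli_Z}. \<not> commute_up_to 1 P (site n j \<sigma>)"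
  proof (rule ccontr)
    assume "\<not> ?thesis"
    then obtain c where "P = c \<cdot>\<^sub>m 1\<^sub>m ?N"
      using scalar_if_commutes_with_sites[OF pauli_involutions_D(4)[OF P(1)]] by blast
    then have "commute_up_to 1 P Z'"
      using pauli_involutions_D(3)[OF Z'(1)] by (simp add: commute_up_to_1 square_mat_algebra[where N = ?N])
    then show False
      using not_commute_and_anticommute[OF pauli_involutions_D(4)[OF P(1)] pauli_involutions_D(4)[OF Z'(1)] _ PZ']
      by simp
  qed
  then obtain j \<sigma> where j: "j < n" "\<sigma> \<in> {pauli_X, pauli_Z}" "\<not> commute_up_to 1 P (site n j \<sigma>)"
    by blast
  define G where "G = site n j \<sigma>"
  have G: "G \<in> pauli_involutions n"
    using j by (simp add: G_def site_involution XZ_pauli)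
  have PG: "commute_up_to (-1) P G"
    using pauli_group_commute_cases[OF pauli_involutions_D(1)[OF P(1)] pauli_involutions_D(1)[OF G]] j(3)
    by (simp add: G_def)
  have "k \<le> j"
    using low(1)[OF refl, of j \<sigma>] j commute_up_to_sym[of 1 "site n j \<sigma>" P] by force
  then have FG: "commute_up_to 1 (site n i \<tau>) G" if "i < k" "\<tau> \<in> {pauli_X, pauli_Z}" for i \<tau>
    unfolding G_def using that j by (intro sites_commute) (auto simp: XZ_pauli)
  obtain R where R: "R \<in> pauli_involutions n" "commute_up_to (-1) P R" "commute_up_to (-1) X R"
    "\<And>F. F \<in> carrier_mat ?N ?N \<Longrightarrow> commute_up_to 1 F G \<Longrightarrow> commute_up_to 1 F Z \<Longrightarrow> commute_up_to 1 F R"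
    using common_anticommuter[OF pauli_involutions_D(1)[OF P(1)] pauli_involutions_D(1)[OF X] n_pos
        pauli_involutions_D(1)[OF G] PG pauli_involutions_D(1)[OF Z] XZ] by metis
  obtain E where E: "E \<in> clifford_unitaries n" "\<phi> E = \<one>\<^bsub>K\<^esub>" "E * P = X * E"
    "\<And>F s. \<lbrakk>F \<in> carrier_mat ?N ?N; s \<in> {1, - 1}; commute_up_to s F P; commute_up_to s F X;
      commute_up_to s F R\<rbrakk> \<Longrightarrow> E * F = F * E"
    using move_via[OF P(1) X R(1,2,3)] by metis
  note EA = correct_conjugate[OF A(1) P X E(1,2,3)]
  have "fixes_sites_below n k (E * A)"
    unfolding fixes_sites_below_def
  proof (intro allI impI ballI)
    fix i \<tau> assume i: "i < k" "\<tau> \<in> {pauli_X, pauli_Z}"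
    note F = low[OF refl i]
    have "E * site n i \<tau> = site n i \<tau> * E"
      using E(4)[OF F(5) _ F(1,2) R(4)[OF F(5) FG[OF i] F(3)]] by simp
    then show "commute_up_to 1 (E * A) (site n i \<tau>)"
      using EA(4) F by blast
  qed
  then show ?thesis
    using that EA(1,2,3) by (simp add: X_def)
qed

text \<open>The conjugate \<open>P\<close> of \<open>Z\<^sub>k\<close> anticommutes with \<open>X\<^sub>k\<close>, as \<open>Z\<^sub>k\<close> does. If \<open>P\<close> and \<open>Z\<^sub>k\<close> anticommute, one quarter turn moves
  one to the other. Otherwise \<open>X\<^sub>k Z\<^sub>k\<close> anticommutes with both and serves as the intermediate station. Since \<open>X\<^sub>k\<close> anticommutes
  with all the operators involved, the quarter turns commute with it.\<close>

lemma reduce_Z: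
  assumes A: "A \<in> clifford_unitaries n" "fixes_sites_below n k A" "commute_up_to 1 A (site n k pauli_X)" and k: "k < n"
  obtains B where "B \<in> clifford_unitaries n" "\<phi> B = \<phi> A" "fixes_sites_below n (Suc k) B"
proof -
  let ?N = "2 ^ n :: nat"
  define X where "X = site n k pauli_X"
  define Z where "Z = site n k pauli_Z"
  have X: "X \<in> pauli_involutions n" and Z: "Z \<in> pauli_involutions n"
    by (simp_all add: X_def Z_def site_involution XZ_pauli)
  have XZ: "commute_up_to (-1) X Z"
    unfolding X_def Z_def using k by (rule site_X_anticommutes_Z)
  have ZX: "commute_up_to (-1) Z X"
    using XZ by (rule commute_up_to_sym) simp
  obtain P where P: "P \<in> pauli_involutions n" "A * Z = P * A"
    using conjugate_involution[OF A(1) Z] .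
  note c = pauli_involutions_D(3)[OF X] pauli_involutions_D(3)[OF Z] pauli_involutions_D(3)[OF P(1)]
  have XP: "commute_up_to (-1) X P"
    using conjugate_keeps_commutation[OF A(1) _ c(1) P Z XZ] A(3) by (simp add: X_def)
  have PX: "commute_up_to (-1) P X"
    using XP by (rule commute_up_to_sym) simp
  have low: "commute_up_to 1 F P" "commute_up_to 1 F X" "commute_up_to 1 F Z" "commute_up_to 1 A F" "F \<in> carrier_mat ?N ?N"
    if "F = site n j \<sigma>" "j < k" "\<sigma> \<in> {pauli_X, pauli_Z}" for F j \<sigma>
  proof -
    show F: "F \<in> carrier_mat ?N ?N" "commute_up_to 1 A F"
      using that A(2) by (auto simp: fixes_sites_below_def site_carrier pauli_carrier XZ_pauli)
    show "commute_up_to 1 F X" "commute_up_to 1 F Z"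
      using that by (auto simp: X_def Z_def sites_commute XZ_pauli)
    show "commute_up_to 1 F P"
      using conjugate_commutes_with_lower_sites[OF A(1,2) P Z_def _ that] by (simp add: XZ_pauli)
  qed
  obtain E where E: "E \<in> clifford_unitaries n" "\<phi> E = \<one>\<^bsub>K\<^esub>" "E * P = Z * E" "E * X = X * E"
    "\<And>F. \<lbrakk>F \<in> carrier_mat ?N ?N; commute_up_to 1 F P; commute_up_to 1 F Z; commute_up_to 1 F X\<rbrakk> \<Longrightarrow> E * F = F * E"
  proof (cases "commute_up_to (-1) P Z")
    case True
    show ?thesis
    proof (rule move_anticommuting[OF P(1) Z True])
      fix E assume E: "E \<in> clifford_unitaries n" "\<phi> E = \<one>\<^bsub>K\<^esub>" "E * P = Z * E"
        "\<And>F s. \<lbrakk>F \<in> carrier_mat ?N ?N; s \<in> {1, - 1}; commute_up_to s F P; commute_up_to s F Z\<rbrakk> \<Longrightarrow> E * F = F * E"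
      show ?thesis
        using that[OF E(1,2,3) E(4)[OF c(1) _ XP XZ]] E(4)[of _ 1] by simp
    qed
  next
    case False
    then have PZ: "commute_up_to 1 P Z"
      using pauli_group_commute_cases pauli_involutions_D(1) P(1) Z by blast
    obtain a where a: "a \<cdot>\<^sub>m (X * Z) \<in> pauli_involutions n"
      using pauli_phase_normalize[OF pauli_group_mult[OF pauli_involutions_D(1)[OF X] pauli_involutions_D(1)[OF Z]] n_pos] .
    define R where "R = a \<cdot>\<^sub>m (X * Z)"
    have R: "commute_up_to (s * t) F R" if "F \<in> carrier_mat ?N ?N" "commute_up_to s F X" "commute_up_to t F Z" for F s t
      unfolding R_def using commute_up_to_mult[OF that(2,3,1) c(1,2)] that(1) c
      by (intro commute_up_to_smult[where N = ?N]) (auto simp: square_mat_algebra)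
    have PR: "commute_up_to (-1) P R" and ZR: "commute_up_to (-1) Z R" and XR: "commute_up_to (-1) X R"
      using R[OF c(3) PX PZ] R[OF c(2) ZX, of 1] R[OF c(1) _ XZ, of 1] by (simp_all add: commute_up_to_1)
    show ?thesis
    proof (rule move_via[OF P(1) Z a[folded R_def] PR ZR])
      fix E assume E: "E \<in> clifford_unitaries n" "\<phi> E = \<one>\<^bsub>K\<^esub>" "E * P = Z * E"
        "\<And>F s. \<lbrakk>F \<in> carrier_mat ?N ?N; s \<in> {1, - 1}; commute_up_to s F P; commute_up_to s F Z; commute_up_to s F R\<rbrakk>
          \<Longrightarrow> E * F = F * E"
      show ?thesis
        using that[OF E(1,2,3) E(4)[OF c(1) _ XP XZ XR]] E(4)[of _ 1] R[of _ 1 1] by simp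
    qed
  qed
  note EA = correct_conjugate[OF A(1) P Z E(1,2,3)]
  have "fixes_sites_below n (Suc k) (E * A)"
    unfolding fixes_sites_below_def
  proof (intro allI impI ballI)
    fix i \<tau> assume i: "i < Suc k" "\<tau> \<in> {pauli_X, pauli_Z}"
    consider "i < k" | "site n i \<tau> = X" | "site n i \<tau> = Z"
      using i by (auto simp: X_def Z_def less_Suc_eq)
    then show "commute_up_to 1 (E * A) (site n i \<tau>)"
    proof cases
      case 1
      note F = low[OF refl 1 i(2)]
      show ?thesis
        using EA(4)[OF F(5,4) E(5)[OF F(5,1,3,2)]] .
    next
      case 2
      then show ?thesis
        using EA(4)[OF c(1) _ E(4)] A(3) by (simp add: X_def)
    next
      case 3
      then show ?thesis
        using EA(3) by simp
    qed
  qed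
  then show ?thesis
    using that EA(1,2) by blast
qed

theorem phi_trivial:
  assumes A: "A \<in> clifford_unitaries n"
  shows "\<phi> A = \<one>\<^bsub>K\<^esub>"
proof -
  have "\<exists>B\<in>clifford_unitaries n. \<phi> B = \<phi> A \<and> fixes_sites_below n k B" if "k \<le> n" for k
    using that
  proof (induction k)
    case 0
    then show ?case
      using A by (auto simp: fixes_sites_below_def)
  next
    case (Suc k)
    then obtain B where "B \<in> clifford_unitaries n" "\<phi> B = \<phi> A" "fixes_sites_below n k B"
      by auto
    then obtain C where "C \<in> clifford_unitaries n" "\<phi> C = \<phi> A" "fixes_sites_below n k C"
      "commute_up_to 1 C (site n k pauli_X)"
      using reduce_X[of B k] Suc.prems by (metis Suc_le_lessD)
    then show ?case
      using reduce_Z[of C k] Suc.prems by (metis Suc_le_lessD)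
  qed
  then obtain B where B: "B \<in> clifford_unitaries n" "\<phi> B = \<phi> A" "fixes_sites_below n n B"
    by blast
  then show ?thesis
    using phi_scalar[OF clifford_unitary[OF B(1)]] unfolding fixes_sites_below_def by metis
qed

end

section \<open>The Clifford group modulo phases\<close>

abbreviation clifford_unitary_group :: "nat \<Rightarrow> complex mat monoid" where
  "clifford_unitary_group n \<equiv> (unitary_group (2 ^ n))\<lparr>carrier := clifford_unitaries n\<rparr>"

lemma group_clifford_unitary_group: "group (clifford_unitary_group n)"
  using subgroup.subgroup_is_group[OF clifford_subgroup group_unitary_group] .

lemma global_phases_eq: "0 < N \<Longrightarrow> global_phases N = {c \<cdot>\<^sub>m 1\<^sub>m N | c. cmod c = 1}"
  by (auto simp: global_phases_def unitary_smult unitary_one dest: cmod_unitary_scalar)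

lemma global_phases_normal: "global_phases (2 ^ n) \<lhd> clifford_unitary_group n"
proof -
  interpret C: group "clifford_unitary_group n"
    by (rule group_clifford_unitary_group)
  let ?N = "2 ^ n :: nat"
  note alg = square_mat_algebra[where N = ?N]
  have inv_phase: "mat_adjoint (c \<cdot>\<^sub>m 1\<^sub>m ?N) = cnj c \<cdot>\<^sub>m 1\<^sub>m ?N" for c
    by (simp add: mat_adjoint_smult)
  have inv: "inv\<^bsub>clifford_unitary_group n\<^esub> A = mat_adjoint A" if "A \<in> clifford_unitaries n" for A
    using that C.inv_equality[of "mat_adjoint A" A] clifford_adjoint[OF that] clifford_unitary[OF that]
    by (simp add: unitary_carrier_iff)
  have sub: "subgroup (global_phases ?N) (clifford_unitary_group n)"
  proof (rule C.subgroupI)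
    show "inv\<^bsub>clifford_unitary_group n\<^esub> A \<in> global_phases ?N" if "A \<in> global_phases ?N" for A
      using that by (auto simp: global_phases_eq inv clifford_phase inv_phase)
    show "A \<otimes>\<^bsub>clifford_unitary_group n\<^esub> B \<in> global_phases ?N"
      if "A \<in> global_phases ?N" "B \<in> global_phases ?N" for A B
      using that by (auto simp: global_phases_eq alg smult_smult_mat norm_mult)
  qed (auto simp: global_phases_eq clifford_phase intro: exI[of _ 1])
  have "A * P * mat_adjoint A = P" if A: "A \<in> clifford_unitaries n" and P: "P \<in> global_phases ?N" for A P
    using clifford_carrier[OF A] unitary_adjoint_right[OF clifford_unitary[OF A]] P
    by (auto simp: global_phases_eq alg)
  then show ?thesis
    using sub by (auto simp: C.normal_inv_iff inv)
qed

lemma group_clifford_group: "group (clifford_group n)"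
  unfolding clifford_group_def by (rule normal.factorgroup_is_group[OF global_phases_normal])

text \<open>A homomorphism on the quotient is pulled back to the Clifford unitaries, where it kills the phases.\<close>

theorem clifford_group_hom_trivial:
  assumes "3 \<le> n" and K: "comm_group K" and \<psi>: "\<psi> \<in> hom (clifford_group n) K"
    and g: "g \<in> carrier (clifford_group n)"
  shows "\<psi> g = \<one>\<^bsub>K\<^esub>"
proof -
  let ?C = "clifford_unitary_group n" and ?H = "global_phases (2 ^ n)"
  interpret K: comm_group K
    by (rule K)
  interpret normal ?H ?C
    by (rule global_phases_normal)
  define \<phi> where "\<phi> A = \<psi> (?H #>\<^bsub>?C\<^esub> A)" for A
  have hom: "\<phi> \<in> hom ?C K"
    using r_coset_hom_Mod \<psi> by (auto simp: hom_def \<phi>_def clifford_group_def Pi_iff)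
  have "phase_killing_hom n K \<phi>"
  proof
    show "\<phi> A \<in> carrier K" if "A \<in> clifford_unitaries n" for A
      using hom that by (auto simp: hom_def)
    show "\<phi> (A * B) = \<phi> A \<otimes>\<^bsub>K\<^esub> \<phi> B" if "A \<in> clifford_unitaries n" "B \<in> clifford_unitaries n" for A B
      using hom that by (auto simp: hom_def)
    show "\<phi> (c \<cdot>\<^sub>m 1\<^sub>m (2 ^ n)) = \<one>\<^bsub>K\<^esub>" if "cmod c = 1" for c
    proof -
      have "?H #>\<^bsub>?C\<^esub> (c \<cdot>\<^sub>m 1\<^sub>m (2 ^ n)) = ?H"
        using that by (intro coset_join2 is_subgroup) (auto simp: clifford_phase global_phases_eq)
      moreover have "\<psi> ?H = \<one>\<^bsub>K\<^esub>"
        using hom_one[OF \<psi> group_clifford_group K.is_group] by (simp add: clifford_group_def)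
      ultimately show ?thesis
        by (simp add: \<phi>_def)
    qed
  qed (use assms in auto)
  then have trivial: "\<phi> A = \<one>\<^bsub>K\<^esub>" if "A \<in> clifford_unitaries n" for A
    using phase_killing_hom.phi_trivial that by blast
  obtain A where "A \<in> clifford_unitaries n" "g = ?H #>\<^bsub>?C\<^esub> A"
    using g by (auto simp: clifford_group_def carrier_FactGroup)
  then show ?thesis
    using trivial by (simp add: \<phi>_def)
qed

lemma trivial_hom: "group K \<Longrightarrow> (\<And>g. g \<in> carrier G \<Longrightarrow> \<chi> g = \<one>\<^bsub>K\<^esub>) \<Longrightarrow> group G \<Longrightarrow> \<chi> \<in> hom G K"
  by (auto simp: hom_def group.is_monoid monoid.m_closed monoid.one_closed monoid.l_one)

lemma comm_group_GL1: "comm_group (GL 1)"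
proof -
  interpret ring "ring_mat TYPE(complex) 1 ()"
    by (rule ring_mat)
  show ?thesis
  proof (rule group.group_comm_groupI[OF units_group])
    fix A B assume AB: "A \<in> carrier (GL 1)" "B \<in> carrier (GL 1)"
    then have c: "A \<in> carrier_mat 1 1" "B \<in> carrier_mat 1 1"
      by (auto simp: units_of_def Units_def ring_mat_simps)
    then have "A * B = B * A"
      by (intro eq_matI) (auto simp: scalar_prod_def)
    then show "A \<otimes>\<^bsub>GL 1\<^esub> B = B \<otimes>\<^bsub>GL 1\<^esub> A"
      by (simp add: units_of_def ring_mat_simps)
  qed
qed

lemma comm_group_complex_units: "comm_group complex_units"
  by (rule comm_groupI) (auto simp: intro!: bexI[of _ "inverse _"])

theorem theorem5p2:
  fixes n :: nat
  assumes "n \<ge> 3"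
  shows "(\<forall>\<chi>. linear_character (clifford_group n) \<chi> \<longleftrightarrow>
              (\<forall>g \<in> carrier (clifford_group n). \<chi> g = 1)) \<and>
         (\<forall>\<chi>. \<chi> \<in> hom (clifford_group n) complex_units \<longleftrightarrow>
              (\<forall>g \<in> carrier (clifford_group n). \<chi> g = 1)) \<and>
         carrier (clifford_group n) = derived (clifford_group n) (carrier (clifford_group n))"
proof -
  let ?G = "clifford_group n"
  interpret G: group ?G
    by (rule group_clifford_group)
  have one_GL: "\<one>\<^bsub>GL 1\<^esub> = 1\<^sub>m 1"
    by (simp add: units_of_def ring_mat_simps)
  have "linear_character ?G \<chi> \<longleftrightarrow> (\<forall>g\<in>carrier ?G. \<chi> g = 1)" for \<chi>
  proof
    assume "linear_character ?G \<chi>"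
    then obtain \<rho> where \<rho>: "\<rho> \<in> hom ?G (GL 1)" "\<And>g. g \<in> carrier ?G \<Longrightarrow> \<chi> g = \<rho> g $$ (0, 0)"
      by (auto simp: is_character_of_degree_def)
    then show "\<forall>g\<in>carrier ?G. \<chi> g = 1"
      using clifford_group_hom_trivial[OF assms comm_group_GL1 \<rho>(1)] by (simp add: one_GL del: One_nat_def)
  next
    assume "\<forall>g\<in>carrier ?G. \<chi> g = 1"
    moreover have "(\<lambda>g. 1\<^sub>m 1) \<in> hom ?G (GL 1)"
      using comm_group_GL1 by (intro trivial_hom) (auto simp: comm_group_def one_GL G.is_group simp del: One_nat_def)
    ultimately show "linear_character ?G \<chi>"
      by (auto simp: is_character_of_degree_def intro!: bexI[of _ "\<lambda>g. 1\<^sub>m 1"])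
  qed
  moreover have "\<chi> \<in> hom ?G complex_units \<longleftrightarrow> (\<forall>g\<in>carrier ?G. \<chi> g = 1)" for \<chi>
  proof
    show "\<forall>g\<in>carrier ?G. \<chi> g = 1" if "\<chi> \<in> hom ?G complex_units"
      using clifford_group_hom_trivial[OF assms comm_group_complex_units that] by simp
    show "\<chi> \<in> hom ?G complex_units" if "\<forall>g\<in>carrier ?G. \<chi> g = 1"
      using that comm_group_complex_units by (intro trivial_hom) (auto simp: comm_group_def G.is_group)
  qed
  moreover have "carrier ?G \<subseteq> derived ?G (carrier ?G)"
  proof
    fix g assume g: "g \<in> carrier ?G"
    have normal: "derived ?G (carrier ?G) \<lhd> ?G"
      by (rule G.derived_self_is_normal)
    \<comment> \<open>The projection to the abelianization is trivial.\<close>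
    have "derived ?G (carrier ?G) #>\<^bsub>?G\<^esub> g = derived ?G (carrier ?G)"
      using clifford_group_hom_trivial[OF assms G.derived_quot_is_comm_group normal.r_coset_hom_Mod[OF normal] g]
      by simp
    then show "g \<in> derived ?G (carrier ?G)"
      using G.coset_join1[OF _ g] G.derived_is_subgroup by simp
  qed
  moreover have "derived ?G (carrier ?G) \<subseteq> carrier ?G"
    by (rule G.derived_in_carrier) simp
  ultimately show ?thesis
    by blast
qed

end
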